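(* Assume $F$ is dyadic. Let $\underline a=(a_1,\dots,a_n)\in\mathbb{Z}_{\ge0}^n$ be non-decreasing and let $B\in\mathcal{H}_n^{\mathrm{nd}}(\mathfrak{o})$ be optimal with $\mathrm{GK}(B)=\underline a$. Then there exist $U\in G_{\underline a}^{\triangle}$ and a standard $\underline a$-admissible involution $\sigma$ such that $B[U]$ is a reduced form of GK type $(\underline a,\sigma)$. In particular, every nondegenerate half-integral symmetric matrix is equivalent to a reduced form.
   Context: $F$ is a non-archimedean local field of characteristic $0$, ring of integers $\mathfrak{o}$, normalized valuation $\mathrm{ord}$; $F$ is dyadic if its residue field has characteristic $2$. A symmetric $B=(b_{ij})\in M_n(F)$ is half-integral if $b_{ii}\in\mathfrak{o}$, $2b_{ij}\in\mathfrak{o}$; $\mathcal{H}_n(\mathfrak{o})$ is the set of these, $\mathcal{H}_n^{\mathrm{nd}}(\mathfrak{o})$ those with $\det\neq0$. $B[X]={}^tXBX$; $B\sim B'$ (equivalent) if $B'=B[U]$, $U\in\mathrm{GL}_n(\mathfrak{o})$. For $\underline a\in\mathbb{Z}_{\ge0}^n$, $\mathcal{M}(\underline a)=\{B\in\mathcal{H}_n(\mathfrak{o}):\mathrm{ord}(b_{ii})\ge a_i,\ \mathrm{ord}(2b_{ij})\ge(a_i+a_j)/2\ (i<j)\}$. $S(B)$ = non-decreasing $\underline a$ with $B\in\mathcal{M}(\underline a)$; $\mathrm{GK}(B)$ = lexicographically greatest element of $\bigcup_{U\in\mathrm{GL}_n(\mathfrak{o})}S(B[U])$; $B$ optimal if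 $\mathrm{GK}(B)\in S(B)$. For non-decreasing $\underline a$: $G_{\underline a}=\{g\in\mathrm{GL}_n(\mathfrak{o}):\mathrm{ord}(g_{ij})\ge(a_j-a_i)/2 \text{ if } a_i<a_j\}$ and $G^{\triangle}_{\underline a}=\{g\in G_{\underline a}: g_{ij}=0 \text{ if } a_i>a_j\}$. Reduced forms: for $\underline a\in\mathbb{Z}_{\ge0}^n$ let $c_1<\dots<c_r$ be the distinct values of the $a_i$ and $I_s=\{i:a_i=c_s\}$ (blocks). For an involution $\sigma\in\mathfrak{S}_n$ put $\mathcal{P}^0=\{i:\sigma(i)=i\}$, $\mathcal{P}^+=\{i:a_i>a_{\sigma(i)}\}$, $\mathcal{P}^-=\{i:a_i<a_{\sigma(i)}\}$ and $\mathcal{P}^\ast_s=\mathcal{P}^\ast\cap I_s$. $\sigma$ is $\underline a$-admissible if (i) $\mathcal{P}^0$ has at most two elements, two distinct elements $i,j$ of $\mathcal{P}^0$ satisfy $a_i\not\equiv a_j\pmod 2$, and for $i\in\mathcal{P}^0$, $a_i=\max\{a_j: j\in\mathcal{P}^0\cup\mathcal{P}^+,\ a_j\equiv a_i \bmod 2\}$; (ii) for each $s$, $\#\mathcal{P}^+_s\le1$ and $\#\mathcal{P}^-_s+\#\mathcal{P}^0_s\le1$; (iii) if $i\in\mathcal{P}^-$ then $a_{\sigma(i)}=\min\{a_j:j\in\mathcal{P}^+, a_j>a_i, a_j\equiv a_i\bmod 2\}$, and if $i\in\mathcal{P}^+$ then $a_{\sigma(i)}=\max\{a_j: j\in\mathcal{P}^-,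 a_j<a_i, a_j\equiv a_i \bmod 2\}$. The pair $(\underline a,\sigma)$ is a GK type. $B=(b_{ij})\in\mathcal{M}(\underline a)$ is a reduced form of GK type $(\underline a,\sigma)$ if (1) for $i\notin\mathcal{P}^0$, $j=\sigma(i)$ with $a_i\le a_j$, the matrix $\begin{pmatrix}b_{ii}&b_{ij}\\ b_{ij}&b_{jj}\end{pmatrix}$ has $\mathrm{GK}=(a_i,a_j)$; (2) $\mathrm{ord}(b_{ii})=a_i$ for $i\in\mathcal{P}^0$; (3) $\mathrm{ord}(2b_{ij})>(a_i+a_j)/2$ whenever $j\ne i,\sigma(i)$. A reduced form means a reduced form of some GK type. For non-decreasing $\underline a$, an $\underline a$-admissible $\sigma$ is standard if: $i\in\mathcal{P}^0_s\cup\mathcal{P}^-_s$ implies $i=\max I_s$; $i\in\mathcal{P}^+_s$ implies $i=\min I_s$; and $a_i=a_{\sigma(i)}$ implies $|\sigma(i)-i|\le1$. *)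

theory Defs
  imports
    "HOL-Library.Extended_Real"
    "HOL-Combinatorics.Permutations"
    "Jordan_Normal_Form.Determinant"
begin

section \<open>Non-archimedean local fields of characteristic 0\<close>

text \<open>
  The field is the whole type. The valuation \<open>vord\<close> (written ord in the literature) is
  extended-real-valued so that \<open>vord 0 = \<infinity>\<close> and so that it can be compared with half-integers;
  on nonzero elements it is integer-valued, and it is normalized: the value 1 is attained.
\<close>

class discretely_valued_field = field_char_0 +
  fixes vord :: "'a \<Rightarrow> ereal"
  assumes vord_eq_infinity_iff: "vord x = \<infinity> \<longleftrightarrow> x = 0"
    and vord_integral: "x \<noteq> 0 \<Longrightarrow> \<exists>k::int. vord x = ereal (real_of_int k)"
    and vord_mult: "vord (x * y) = vord x + vord y"
    and vord_add: "vord (x + y) \<ge> min (vord x) (vord y)"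
    and vord_normalized: "\<exists>x. vord x = 1"

definition (in discretely_valued_field) valuation_ring :: "'a set" where
  "valuation_ring = {x. vord x \<ge> 0}"

definition (in discretely_valued_field) residue_rel :: "('a \<times> 'a) set" where
  "residue_rel = {(x, y). x \<in> valuation_ring \<and> y \<in> valuation_ring \<and> vord (x - y) > 0}"

definition (in discretely_valued_field) residue_field :: "'a set set" where
  "residue_field = valuation_ring // residue_rel"

text \<open>A local field: complete for the discrete valuation, with finite residue field.\<close>

class nonarch_local_field = discretely_valued_field +
  assumes vord_complete:
      "(\<forall>k::nat. \<exists>N::nat. \<forall>m\<ge>N. \<forall>n\<ge>N. vord (X m - X n) \<ge> ereal (real k)) \<Longrightarrow>
       \<exists>L. \<forall>k::nat. \<exists>N::nat. \<forall>n\<ge>N. vord (X n - L) \<ge> ereal (real k)"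
    and finite_residue_field: "finite (residue_field :: 'a set set)"

text \<open>
  The characteristic of the residue field, following the library's definition of the
  characteristic of a semiring: the Gcd of all \<open>k\<close> whose image in the residue field is zero.
\<close>

definition residue_char :: "'a::discretely_valued_field itself \<Rightarrow> nat" where
  "residue_char _ = Gcd {k. residue_rel `` {of_nat k :: 'a} = residue_rel `` {0}}"

definition dyadic :: "'a::discretely_valued_field itself \<Rightarrow> bool" where
  "dyadic T \<longleftrightarrow> residue_char T = 2"


section \<open>Half-integral matrices and the Gross-Keating invariant\<close>

text \<open>
  Matrix indices and the positions in a tuple \<open>(a\<^sub>1, \<dots>, a\<^sub>n)\<close> are numbered from 0; a tuple of
  non-negative integers is a list of naturals, whose length is \<open>n\<close>.
\<close>

definition half_integral :: "nat \<Rightarrow> 'a::discretely_valued_field mat set" where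
  "half_integral n = {B \<in> carrier_mat n n. transpose_mat B = B \<and>
     (\<forall>i<n. B $$ (i, i) \<in> valuation_ring) \<and>
     (\<forall>i<n. \<forall>j<n. 2 * B $$ (i, j) \<in> valuation_ring)}"

definition half_integral_nd :: "nat \<Rightarrow> 'a::discretely_valued_field mat set" where
  "half_integral_nd n = {B \<in> half_integral n. det B \<noteq> 0}"

definition integral_mat :: "nat \<Rightarrow> 'a::discretely_valued_field mat set" where
  "integral_mat n = {U \<in> carrier_mat n n. \<forall>i<n. \<forall>j<n. U $$ (i, j) \<in> valuation_ring}"

definition GL_integral :: "nat \<Rightarrow> 'a::discretely_valued_field mat set" where
  "GL_integral n = {U \<in> integral_mat n. \<exists>V \<in> integral_mat n. inverts_mat U V \<and> inverts_mat V U}"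

text \<open>\<open>mat_act B X\<close> is \<open>B[X]\<close>.\<close>

definition mat_act :: "'a::comm_ring_1 mat \<Rightarrow> 'a mat \<Rightarrow> 'a mat" where
  "mat_act B X = transpose_mat X * B * X"

definition mat_equivalent :: "'a::discretely_valued_field mat \<Rightarrow> 'a mat \<Rightarrow> bool" where
  "mat_equivalent B B' \<longleftrightarrow> (\<exists>U \<in> GL_integral (dim_row B). B' = mat_act B U)"

definition M_set :: "nat list \<Rightarrow> 'a::discretely_valued_field mat set" where
  "M_set a = {B \<in> half_integral (length a).
     (\<forall>i<length a. vord (B $$ (i, i)) \<ge> ereal (real (a ! i))) \<and>
     (\<forall>i j. i < j \<and> j < length a \<longrightarrow>
        vord (2 * B $$ (i, j)) \<ge> ereal ((real (a ! i) + real (a ! j)) / 2))}"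

definition S_set :: "'a::discretely_valued_field mat \<Rightarrow> nat list set" where
  "S_set B = {a. sorted a \<and> B \<in> M_set a}"

text \<open>
  \<open>is_GK B a\<close> says \<open>GK(B) = a\<close>. It is a relation because the lexicographically greatest element
  need not exist when \<open>B\<close> is degenerate; then no \<open>a\<close> is related to \<open>B\<close>. The library relation
  \<open>lex\<close> is the strict lexicographic order on lists of equal length.
\<close>

definition is_GK :: "'a::discretely_valued_field mat \<Rightarrow> nat list \<Rightarrow> bool" where
  "is_GK B a \<longleftrightarrow>
     (let T = (\<Union>U \<in> GL_integral (dim_row B). S_set (mat_act B U))
      in a \<in> T \<and> (\<forall>b \<in> T. b = a \<or> (b, a) \<in> lex less_than))"

definition optimal :: "'a::discretely_valued_field mat \<Rightarrow> bool" where
  "optimal B \<longleftrightarrow> (\<exists>a. is_GK B a \<and> a \<in> S_set B)"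

definition G_set :: "nat list \<Rightarrow> 'a::discretely_valued_field mat set" where
  "G_set a = {g \<in> GL_integral (length a). \<forall>i<length a. \<forall>j<length a.
     a ! i < a ! j \<longrightarrow> vord (g $$ (i, j)) \<ge> ereal ((real (a ! j) - real (a ! i)) / 2)}"

definition G_tri :: "nat list \<Rightarrow> 'a::discretely_valued_field mat set" where
  "G_tri a = {g \<in> G_set a. \<forall>i<length a. \<forall>j<length a. a ! i > a ! j \<longrightarrow> g $$ (i, j) = 0}"


section \<open>Admissible involutions and reduced forms\<close>

text \<open>
  Membership is part of being a minimum or maximum, so that these fail on the empty set
  (where \<open>Min\<close> and \<open>Max\<close> would be unspecified).
\<close>

definition is_min_of :: "nat \<Rightarrow> nat set \<Rightarrow> bool" where
  "is_min_of m A \<longleftrightarrow> m \<in> A \<and> (\<forall>x \<in> A. m \<le> x)"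

definition is_max_of :: "nat \<Rightarrow> nat set \<Rightarrow> bool" where
  "is_max_of m A \<longleftrightarrow> m \<in> A \<and> (\<forall>x \<in> A. x \<le> m)"

text \<open>Blocks are indexed by the value \<open>c = c\<^sub>s\<close> instead of by \<open>s\<close>.\<close>

definition block :: "nat list \<Rightarrow> nat \<Rightarrow> nat set" where
  "block a c = {i. i < length a \<and> a ! i = c}"

definition P_zero :: "nat list \<Rightarrow> (nat \<Rightarrow> nat) \<Rightarrow> nat set" where
  "P_zero a \<sigma> = {i. i < length a \<and> \<sigma> i = i}"

definition P_plus :: "nat list \<Rightarrow> (nat \<Rightarrow> nat) \<Rightarrow> nat set" where
  "P_plus a \<sigma> = {i. i < length a \<and> a ! i > a ! \<sigma> i}"

definition P_minus :: "nat list \<Rightarrow> (nat \<Rightarrow> nat) \<Rightarrow> nat set" where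
  "P_minus a \<sigma> = {i. i < length a \<and> a ! i < a ! \<sigma> i}"

text \<open>An involution is a permutation whose square is the identity; the identity is included.\<close>

definition admissible :: "nat list \<Rightarrow> (nat \<Rightarrow> nat) \<Rightarrow> bool" where
  "admissible a \<sigma> \<longleftrightarrow>
     \<sigma> permutes {..<length a} \<and> \<sigma> \<circ> \<sigma> = id \<and>
     card (P_zero a \<sigma>) \<le> 2 \<and>
     (\<forall>i \<in> P_zero a \<sigma>. \<forall>j \<in> P_zero a \<sigma>. i \<noteq> j \<longrightarrow> a ! i mod 2 \<noteq> a ! j mod 2) \<and>
     (\<forall>i \<in> P_zero a \<sigma>.
        is_max_of (a ! i) {a ! j | j. j \<in> P_zero a \<sigma> \<union> P_plus a \<sigma> \<and> a ! j mod 2 = a ! i mod 2}) \<and>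
     (\<forall>c \<in> set a. card (P_plus a \<sigma> \<inter> block a c) \<le> 1 \<and>
        card (P_minus a \<sigma> \<inter> block a c) + card (P_zero a \<sigma> \<inter> block a c) \<le> 1) \<and>
     (\<forall>i \<in> P_minus a \<sigma>.
        is_min_of (a ! \<sigma> i) {a ! j | j. j \<in> P_plus a \<sigma> \<and> a ! j > a ! i \<and> a ! j mod 2 = a ! i mod 2}) \<and>
     (\<forall>i \<in> P_plus a \<sigma>.
        is_max_of (a ! \<sigma> i) {a ! j | j. j \<in> P_minus a \<sigma> \<and> a ! j < a ! i \<and> a ! j mod 2 = a ! i mod 2})"

definition standard_admissible :: "nat list \<Rightarrow> (nat \<Rightarrow> nat) \<Rightarrow> bool" where
  "standard_admissible a \<sigma> \<longleftrightarrow> sorted a \<and> admissible a \<sigma> \<and>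
     (\<forall>c \<in> set a.
        (\<forall>i \<in> (P_zero a \<sigma> \<union> P_minus a \<sigma>) \<inter> block a c. i = Max (block a c)) \<and>
        (\<forall>i \<in> P_plus a \<sigma> \<inter> block a c. i = Min (block a c))) \<and>
     (\<forall>i<length a. a ! i = a ! \<sigma> i \<longrightarrow> \<bar>int (\<sigma> i) - int i\<bar> \<le> 1)"

definition reduced_form_of_type ::
    "nat list \<Rightarrow> (nat \<Rightarrow> nat) \<Rightarrow> 'a::discretely_valued_field mat \<Rightarrow> bool" where
  "reduced_form_of_type a \<sigma> B \<longleftrightarrow> admissible a \<sigma> \<and> B \<in> M_set a \<and>
     (\<forall>i<length a. i \<notin> P_zero a \<sigma> \<and> a ! i \<le> a ! \<sigma> i \<longrightarrow>
        is_GK (mat_of_rows_list 2 [[B $$ (i, i), B $$ (i, \<sigma> i)],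
                                   [B $$ (i, \<sigma> i), B $$ (\<sigma> i, \<sigma> i)]])
              [a ! i, a ! \<sigma> i]) \<and>
     (\<forall>i \<in> P_zero a \<sigma>. vord (B $$ (i, i)) = ereal (real (a ! i))) \<and>
     (\<forall>i<length a. \<forall>j<length a. j \<noteq> i \<and> j \<noteq> \<sigma> i \<longrightarrow>
        vord (2 * B $$ (i, j)) > ereal ((real (a ! i) + real (a ! j)) / 2))"

definition reduced_form :: "'a::discretely_valued_field mat \<Rightarrow> bool" where
  "reduced_form B \<longleftrightarrow> (\<exists>a \<sigma>. reduced_form_of_type a \<sigma> B)"

end

(*
  Dividing x_i by the (formal) power pi^(a_i/2) turns B in M(a) into a quadratic form over the
  perfect residue field, one form for each parity of a_i, on a space flagged by the values a_i.
  If B is optimal, the restriction to each member of the flag is nondegenerate: a vector v of the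
  s-th step that is orthogonal to this step and on which the form vanishes would allow c_s to be
  raised to c_s + 1 at the cost of lowering only larger entries of a, which increases a
  lexicographically. As squaring is bijective on the residue field, the radical of the bilinear form
  on each step then has dimension at most 1. Running through the flag and splitting off hyperbolic
  pairs yields the involution: a vector z spanning the radical of one step is either carried along
  as a fixed point or is paired with a vector p of a later block, in which case z lies in P^- and
  p in P^+.
*)
theory Submission
  imports Defs "Jordan_Normal_Form.Column_Operations"
begin

text \<open>The residue forms are never constructed. An entry vanishes in its residue form when its
  bound in \<open>M_set a\<close> can be improved by one doubled unit, so the whole argument
  consists of inequalities between orders in the field itself. What shapes the scan is that
  \<open>G_tri\<close> lets a basis vector be added only to vectors of equal or larger value. A
  linked pair can clear later indices but not earlier ones, so the earlier ones must already be
  unlinked from it. A radical vector z has nothing to clear its later links with. These links are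
  tolerated until the scan reaches the first block that z meets, and there its partner has to be the
  first index of the block for the involution to be standard. Residue characteristic 2 enters
  through the positive order of 2: it makes every vector orthogonal to itself in the residue form,
  makes squaring injective on residues, and lets the off-diagonal entries decide the determinant of
  a binary block. The second assertion also requires that the Gross-Keating invariant exists; the
  determinant of twice the form bounds all candidates.\<close>

section \<open>Half-integral bounds for the valuation\<close>

text \<open>Doubling turns the bounds \<open>(a ! i + a ! j) / 2\<close> into integers. As orders
  are integers, the strict bound by \<open>m / 2\<close> is \<open>hord_ge (m + 1)\<close>, and its
  negation bounds the order from above by \<open>m / 2\<close>; one predicate thus serves for lower
  and upper bounds.\<close>

definition hord_ge :: "int \<Rightarrow> 'a::discretely_valued_field \<Rightarrow> bool" where
  "hord_ge m x \<longleftrightarrow> ereal (real_of_int m / 2) \<le> vord x"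

lemma vord_zero [simp]: "vord (0::'a::discretely_valued_field) = \<infinity>"
  using vord_eq_infinity_iff[of "0::'a"] by simp

lemma hord_ge_zero [simp]: "hord_ge m 0"
  by (simp add: hord_ge_def)

lemma hord_ge_cases:
  fixes x :: "'a::discretely_valued_field"
  assumes "x \<noteq> 0"
  obtains k :: int where "vord x = ereal (real_of_int k)" "\<And>m. hord_ge m x \<longleftrightarrow> m \<le> 2 * k"
proof -
  obtain k :: int where k: "vord x = ereal (real_of_int k)"
    using vord_integral[OF assms] by blast
  have "hord_ge m x \<longleftrightarrow> m \<le> 2 * k" for m
  proof -
    have "hord_ge m x \<longleftrightarrow> real_of_int m \<le> real_of_int (2 * k)"
      unfolding hord_ge_def k by (simp add: field_simps)
    then show ?thesis by (simp only: of_int_le_iff)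
  qed
  with k that show thesis by blast
qed

lemma hord_ge_mono: "hord_ge m x \<Longrightarrow> k \<le> m \<Longrightarrow> hord_ge k x"
  unfolding hord_ge_def by (erule order_trans[rotated]) simp

lemma hord_ge_add: "hord_ge m x \<Longrightarrow> hord_ge m y \<Longrightarrow> hord_ge m (x + y)"
  unfolding hord_ge_def using vord_add[of x y] by (meson min.bounded_iff order_trans)

lemma hord_ge_mult:
  assumes "hord_ge m x" "hord_ge k y"
  shows "hord_ge (m + k) (x * y)"
proof -
  have "ereal (real_of_int m / 2) + ereal (real_of_int k / 2) \<le> vord x + vord y"
    using assms unfolding hord_ge_def by (rule add_mono)
  then show ?thesis
    unfolding hord_ge_def vord_mult by (simp add: add_divide_distrib)
qed

lemma vord_one [simp]: "vord (1::'a::discretely_valued_field) = 0"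
proof -
  obtain k :: int where k: "vord (1::'a) = ereal (real_of_int k)"
    using vord_integral[of "1::'a"] by auto
  have "vord (1::'a) = vord (1::'a) + vord (1::'a)"
    using vord_mult[of "1::'a" 1] by simp
  then show ?thesis using k by simp
qed

lemma vord_minus_one: "vord (-1::'a::discretely_valued_field) = 0"
proof -
  obtain k :: int where k: "vord (-1::'a) = ereal (real_of_int k)"
    using vord_integral[of "-1::'a"] by auto
  have "vord (1::'a) = vord (-1::'a) + vord (-1::'a)"
    using vord_mult[of "-1::'a" "-1"] by simp
  then show ?thesis using k by simp
qed

lemma vord_minus [simp]: "vord (- x) = vord (x::'a::discretely_valued_field)"
  using vord_mult[of "-1" x] by (simp add: vord_minus_one)

lemma hord_ge_minus [simp]: "hord_ge m (- x) \<longleftrightarrow> hord_ge m x"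
  by (simp add: hord_ge_def)

lemma hord_ge_diff: "hord_ge m x \<Longrightarrow> hord_ge m y \<Longrightarrow> hord_ge m (x - y)"
  using hord_ge_add[of m x "- y"] by simp

lemma hord_ge_add_cancel: "hord_ge m y \<Longrightarrow> hord_ge m (x + y) \<longleftrightarrow> hord_ge m x"
  using hord_ge_add[of m x y] hord_ge_diff[of m "x + y" y] by auto

lemma hord_ge_one [simp]: "hord_ge 0 1"
  by (simp add: hord_ge_def)

lemma valuation_ring_iff: "x \<in> valuation_ring \<longleftrightarrow> hord_ge 0 x"
  by (simp add: valuation_ring_def hord_ge_def zero_ereal_def)

lemma hord_ge_sum: "(\<And>i. i \<in> S \<Longrightarrow> hord_ge m (f i)) \<Longrightarrow> hord_ge m (sum f S)"
  by (induction S rule: infinite_finite_induct) (auto intro: hord_ge_add)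

lemma hord_ge_prod:
  "finite S \<Longrightarrow> (\<And>i. i \<in> S \<Longrightarrow> hord_ge (g i) (f i)) \<Longrightarrow> hord_ge (sum g S) (prod f S)"
  by (induction S rule: finite_induct) (auto intro: hord_ge_mult)

lemma hord_ge_of_nat: "hord_ge 0 (of_nat k)"
  by (induction k) (auto intro: hord_ge_add)

lemma hord_ge_two: "hord_ge 0 2"
  using hord_ge_of_nat[of 2] by simp

lemma hord_ge_power: "hord_ge 0 x \<Longrightarrow> hord_ge 0 (x ^ k)"
  using hord_ge_mult[of 0 x 0] by (induction k) auto

text \<open>Twice an order is even, so an odd bound is never attained. This is how the parities of
  the \<open>a ! i\<close> enter.\<close>

lemma hord_ge_odd:
  assumes "hord_ge m x" "odd m"
  shows "hord_ge (m + 1) x"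
proof (cases "x = 0")
  case False
  then obtain k :: int where k: "\<And>m. hord_ge m x \<longleftrightarrow> m \<le> 2 * k"
    using hord_ge_cases by blast
  from assms show ?thesis unfolding k by presburger
qed simp

text \<open>Read as upper bounds on orders, the negations add up under products; each of them also
  excludes 0.\<close>

lemma not_hord_ge_mult:
  assumes x: "\<not> hord_ge (m + 1) x" and y: "\<not> hord_ge (k + 1) y"
  shows "\<not> hord_ge (m + k + 1) (x * y)"
proof -
  have nz: "x \<noteq> 0" "y \<noteq> 0" using x y by auto
  obtain p :: int where p: "vord x = ereal p" "\<And>m. hord_ge m x \<longleftrightarrow> m \<le> 2 * p"
    using hord_ge_cases[OF nz(1)] by blast
  obtain q :: int where q: "vord y = ereal q" "\<And>m. hord_ge m y \<longleftrightarrow> m \<le> 2 * q"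
    using hord_ge_cases[OF nz(2)] by blast
  obtain r :: int where r: "vord (x * y) = ereal r" "\<And>m. hord_ge m (x * y) \<longleftrightarrow> m \<le> 2 * r"
    using hord_ge_cases[of "x * y"] nz by auto
  have "r = p + q" using p(1) q(1) r(1) vord_mult[of x y] by simp
  then show ?thesis using p(2) q(2) r(2) x y by simp
qed

text \<open>Meant for a divisor that attains its bound in \<open>M_set\<close>: the upper bound
  \<open>k / 2\<close> on its order makes it nonzero and bounds the order of the quotient from
  below.\<close>

lemma hord_ge_divide:
  assumes "hord_ge m x" "\<not> hord_ge (k + 1) y"
  shows "hord_ge (m - k) (x / y)"
proof (rule ccontr)
  assume "\<not> hord_ge (m - k) (x / y)"
  then have "\<not> hord_ge ((m - k - 1) + k + 1) (x / y * y)"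
    using assms(2) by (intro not_hord_ge_mult) simp_all
  moreover have "y \<noteq> 0" using assms(2) by auto
  ultimately show False using assms(1) by simp
qed

lemma vord_eq_iff: "vord x = ereal (real k) \<longleftrightarrow> hord_ge (2 * int k) x \<and> \<not> hord_ge (2 * int k + 1) x"
proof (cases "x = 0")
  case False
  then obtain p :: int where p: "vord x = ereal (real_of_int p)" "\<And>m. hord_ge m x \<longleftrightarrow> m \<le> 2 * p"
    using hord_ge_cases by blast
  have "vord x = ereal (real k) \<longleftrightarrow> p = int k" unfolding p(1) by simp linarith
  then show ?thesis unfolding p(2) by presburger
qed simp

lemma vord_gt_half_iff:
  "vord x > ereal ((real k + real l) / 2) \<longleftrightarrow> hord_ge (int k + int l + 1) x"
proof (cases "x = 0")
  case False
  then obtain p :: int where p: "vord x = ereal (real_of_int p)" "\<And>m. hord_ge m x \<longleftrightarrow> m \<le> 2 * p"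
    using hord_ge_cases by blast
  have "vord x > ereal ((real k + real l) / 2) \<longleftrightarrow>
      real_of_int (int k + int l) < real_of_int (2 * p)" unfolding p(1) by (simp add: field_simps)
  then show ?thesis unfolding p(2) of_int_less_iff by presburger
qed simp

lemma vord_ge_half_iff:
  "vord x \<ge> ereal ((real k + real l) / 2) \<longleftrightarrow> hord_ge (int k + int l) x"
  by (simp add: hord_ge_def)

lemma vord_ge_half_diff_iff:
  "vord x \<ge> ereal ((real k - real l) / 2) \<longleftrightarrow> hord_ge (int k - int l) x"
  by (simp add: hord_ge_def)

lemma vord_ge_iff: "vord x \<ge> ereal (real k) \<longleftrightarrow> hord_ge (2 * int k) x"
  by (simp add: hord_ge_def)

lemma not_hord_ge_power:
  assumes "\<not> hord_ge 1 x" shows "\<not> hord_ge 1 (x ^ k)"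
proof (induction k)
  case 0
  show ?case by (simp add: hord_ge_def zero_ereal_def)
next
  case (Suc k)
  then show ?case using not_hord_ge_mult[of 0 x 0 "x ^ k"] assms by simp
qed

section \<open>Square roots in the residue field\<close>

lemma residue_rel_iff: "(x, y) \<in> residue_rel \<longleftrightarrow> hord_ge 0 x \<and> hord_ge 0 y \<and> hord_ge 1 (x - y)"
  using vord_gt_half_iff[of 0 0 "x - y"]
  by (simp add: residue_rel_def valuation_ring_iff zero_ereal_def)

lemma residue_class_eqD:
  assumes "residue_rel `` {x} = residue_rel `` {y}" "hord_ge 0 y"
  shows "hord_ge 1 (x - y)"
proof -
  have "y \<in> residue_rel `` {y}" using assms(2) by (simp add: residue_rel_iff)
  then have "(x, y) \<in> residue_rel" unfolding assms(1)[symmetric] by simp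
  then show ?thesis by (simp add: residue_rel_iff)
qed

text \<open>\<open>residue_char\<close> is the Gcd of all \<open>k\<close> that vanish in the
  residue field. If 2 were a unit there, half of the least positive such \<open>k\<close> would
  vanish as well.\<close>

lemma dyadic_hord_ge_two:
  assumes "dyadic TYPE('a::discretely_valued_field)"
  shows "hord_ge 1 (2::'a)"
proof (rule ccontr)
  assume two: "\<not> hord_ge 1 (2::'a)"
  define S where "S = {k. hord_ge 1 (of_nat k :: 'a)}"
  have iff: "residue_rel `` {of_nat k :: 'a} = residue_rel `` {0} \<longleftrightarrow> k \<in> S" for k
  proof
    assume "residue_rel `` {of_nat k :: 'a} = residue_rel `` {0}"
    from residue_class_eqD[OF this] show "k \<in> S" by (simp add: S_def)
  next
    assume k: "k \<in> S"
    have "hord_ge 1 (of_nat k - y) \<longleftrightarrow> hord_ge 1 (0 - y)" for y :: 'a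
      using hord_ge_add_cancel[of 1 "of_nat k" "- y"] k by (simp add: S_def)
    then show "residue_rel `` {of_nat k :: 'a} = residue_rel `` {0}"
      by (simp add: Image_def residue_rel_iff hord_ge_of_nat)
  qed
  have gcd: "Gcd S = 2"
    using assms unfolding dyadic_def residue_char_def iff by simp
  \<comment> \<open>A subset of \<open>{0}\<close> would have Gcd 0 instead of 2.\<close>
  then have "\<exists>k. k \<in> S \<and> k \<noteq> 0" by (metis Gcd_0_iff numeral_neq_zero singletonI subsetI)
  then obtain k where k: "k \<in> S" "k \<noteq> 0" and min: "\<And>m. m \<in> S \<Longrightarrow> m \<noteq> 0 \<Longrightarrow> k \<le> m"
    using exists_least_iff[of "\<lambda>k. k \<in> S \<and> k \<noteq> 0"] by (metis not_le)
  have "2 dvd k" using gcd k(1) Gcd_dvd by metis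
  then obtain m where m: "k = 2 * m" by blast
  have "m \<in> S"
  proof (rule ccontr)
    assume "m \<notin> S"
    then have "\<not> hord_ge (0 + 0 + 1) (2 * of_nat m :: 'a)"
      using two by (intro not_hord_ge_mult) (simp_all add: S_def)
    then show False using k(1) m by (simp add: S_def)
  qed
  then show False using min[of m] k(2) m by simp
qed

text \<open>Squaring is additive modulo 2: \<open>(x - y) ^ 2\<close> and
  \<open>x ^ 2 - y ^ 2\<close> differ by a multiple of 2, and an element whose square has positive
  order has positive order itself.\<close>

lemma residue_square_inj:
  fixes x y :: "'a::discretely_valued_field"
  assumes two: "hord_ge 1 (2::'a)" and x: "hord_ge 0 x" and y: "hord_ge 0 y"
    and sq: "hord_ge 1 (x ^ 2 - y ^ 2)"
  shows "hord_ge 1 (x - y)"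
proof (rule ccontr)
  assume "\<not> hord_ge 1 (x - y)"
  then have "\<not> hord_ge 1 ((x - y) ^ 2)" by (rule not_hord_ge_power)
  moreover have "hord_ge (1 + 0) (2 * (y * (y - x)))"
    using two hord_ge_mult[OF y hord_ge_diff[OF y x]] by (intro hord_ge_mult) simp_all
  then have "hord_ge 1 ((x ^ 2 - y ^ 2) + 2 * (y * (y - x)))"
    using sq by (intro hord_ge_add) simp_all
  moreover have "(x ^ 2 - y ^ 2) + 2 * (y * (y - x)) = (x - y) ^ 2"
    by (simp add: power2_eq_square algebra_simps)
  ultimately show False by simp
qed

text \<open>Squaring is injective on residues, so the iterated squares of \<open>w\<close>, which take only
  finitely many residues, return to \<open>w\<close>.\<close>

lemma residue_square_root:
  fixes w :: "'a::nonarch_local_field"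
  assumes two: "hord_ge 1 (2::'a)" and w: "hord_ge 0 w"
  obtains s where "hord_ge 0 s" "hord_ge 1 (s ^ 2 - w)"
proof -
  define X where "X i = w ^ (2 ^ i)" for i :: nat
  have X: "hord_ge 0 (X i)" for i
    unfolding X_def using w by (rule hord_ge_power)
  have sq: "X (Suc i) = X i ^ 2" for i
    by (simp add: X_def power_mult[symmetric] mult.commute)
  have "range (\<lambda>i. residue_rel `` {X i}) \<subseteq> residue_field"
    unfolding residue_field_def using X by (auto intro!: quotientI simp: valuation_ring_iff)
  then have "finite (range (\<lambda>i. residue_rel `` {X i}))"
    using finite_residue_field finite_subset by blast
  then have "\<not> inj (\<lambda>i. residue_rel `` {X i})"
    using finite_imageD infinite_UNIV_nat by blast
  then obtain i j where ij: "i \<noteq> j" "residue_rel `` {X i} = residue_rel `` {X j}"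
    unfolding inj_def by blast
  have "\<exists>i j. i < j \<and> hord_ge 1 (X j - X i)"
  proof (cases "i < j")
    case True
    then show ?thesis using residue_class_eqD[OF ij(2)[symmetric] X] by blast
  next
    case False
    then show ?thesis using ij(1) residue_class_eqD[OF ij(2) X] by (meson linorder_neqE_nat)
  qed
  then obtain i j where ij: "i < j" "hord_ge 1 (X j - X i)" by blast
  \<comment> \<open>Injectivity of squaring cancels \<open>i\<close> squarings on both sides, so a
    repetition anywhere in the orbit gives a return to its start.\<close>
  have "hord_ge 1 (X (d + i) - X i) \<Longrightarrow> hord_ge 1 (X d - X 0)" for d
  proof (induction i)
    case (Suc i)
    have "hord_ge 1 (X (d + i) - X i)"
      using Suc.prems by (intro residue_square_inj[OF two X X]) (simp add: sq)
    then show ?case by (rule Suc.IH)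
  qed simp
  from this[of "j - i"] ij have "hord_ge 1 (X (j - i) - X 0)" by simp
  \<comment> \<open>The return time is positive, so the iterate just before the return exists; it is
    the square root.\<close>
  moreover obtain m where "j - i = Suc m" using ij(1) by (metis Suc_diff_Suc)
  ultimately have "hord_ge 1 (X m ^ 2 - w)" by (simp add: sq) (simp add: X_def)
  then show thesis using X that by blast
qed

section \<open>Elementary transformations inside \<open>G_tri\<close>\<close>

text \<open>Symmetry extends the off-diagonal bound to all ordered pairs, and half-integrality
  follows from the bounds because the entries of \<open>a\<close> are natural numbers.\<close>

lemma M_set_iff:
  "C \<in> M_set a \<longleftrightarrow> C \<in> carrier_mat (length a) (length a) \<and>
     (\<forall>i<length a. \<forall>j<length a. C $$ (i, j) = C $$ (j, i)) \<and>
     (\<forall>i<length a. hord_ge (2 * int (a ! i)) (C $$ (i, i))) \<and>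
     (\<forall>i<length a. \<forall>j<length a. i \<noteq> j \<longrightarrow> hord_ge (int (a ! i) + int (a ! j)) (2 * C $$ (i, j)))"
    (is "_ \<longleftrightarrow> ?car \<and> ?sym \<and> ?diag \<and> ?off")
proof
  assume C: "C \<in> M_set a"
  then have car: ?car and tr: "transpose_mat C = C" and diag: ?diag
    and off: "\<And>i j. i < j \<Longrightarrow> j < length a \<Longrightarrow> hord_ge (int (a ! i) + int (a ! j)) (2 * C $$ (i, j))"
    by (auto simp: M_set_def half_integral_def vord_ge_iff vord_ge_half_iff)
  have sym: ?sym
    using car by (metis carrier_matD index_transpose_mat(1) tr)
  have ?off
  proof (intro allI impI)
    fix i j assume "i < length a" "j < length a" "i \<noteq> j"
    then show "hord_ge (int (a ! i) + int (a ! j)) (2 * C $$ (i, j))"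
      using off[of i j] off[of j i] sym by (cases "i < j") (auto simp: add.commute)
  qed
  with car sym diag show "?car \<and> ?sym \<and> ?diag \<and> ?off" by blast
next
  assume C: "?car \<and> ?sym \<and> ?diag \<and> ?off"
  have int: "hord_ge 0 (C $$ (i, i))" if "i < length a" for i
    using C that hord_ge_mono[of "2 * int (a ! i)" "C $$ (i, i)" 0] by simp
  have "hord_ge 0 (2 * C $$ (i, j))" if "i < length a" "j < length a" for i j
  proof (cases "i = j")
    case True
    then show ?thesis using hord_ge_mult[OF hord_ge_two int[OF that(1)]] by simp
  next
    case False
    then show ?thesis
      using C that hord_ge_mono[of "int (a ! i) + int (a ! j)" "2 * C $$ (i, j)" 0] by simp
  qed
  moreover have "transpose_mat C = C" using C by (intro eq_matI) auto
  ultimately show "C \<in> M_set a"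
    using C int by (simp add: M_set_def half_integral_def vord_ge_iff vord_ge_half_iff valuation_ring_iff)
qed

lemma M_setD:
  assumes "C \<in> M_set a" "i < length a" "j < length a"
  shows "C $$ (i, j) = C $$ (j, i)"
    and "hord_ge (2 * int (a ! i)) (C $$ (i, i))"
    and "i \<noteq> j \<Longrightarrow> hord_ge (int (a ! i) + int (a ! j)) (2 * C $$ (i, j))"
  using assms by (auto simp: M_set_iff)

lemma M_set_carrier: "C \<in> M_set a \<Longrightarrow> C \<in> carrier_mat (length a) (length a)"
  by (simp add: M_set_iff)

section \<open>Integral matrices, \<open>GL_integral\<close> and its action on forms\<close>

lemma integral_mat_iff:
  "U \<in> integral_mat n \<longleftrightarrow> U \<in> carrier_mat n n \<and> (\<forall>i<n. \<forall>j<n. hord_ge 0 (U $$ (i, j)))"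
  by (simp add: integral_mat_def valuation_ring_iff)

lemma times_mat_index:
  assumes "A \<in> carrier_mat n n" "B \<in> carrier_mat n n" "i < n" "j < n"
  shows "(A * B) $$ (i, j) = (\<Sum>k<n. A $$ (i, k) * B $$ (k, j))"
  using assms by (auto simp: scalar_prod_def atLeast0LessThan intro!: sum.cong)

lemma integral_mat_mult:
  assumes "U \<in> integral_mat n" "V \<in> integral_mat n"
  shows "U * V \<in> integral_mat n"
proof -
  have "hord_ge 0 (U $$ (i, k) * V $$ (k, j))" if "i < n" "j < n" "k < n" for i j k
    using hord_ge_mult[of 0 "U $$ (i, k)" 0 "V $$ (k, j)"] assms that by (simp add: integral_mat_iff)
  moreover have car: "U \<in> carrier_mat n n" "V \<in> carrier_mat n n"
    using assms by (simp_all add: integral_mat_iff)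
  ultimately show ?thesis
    unfolding integral_mat_iff
    by (auto simp: times_mat_index[OF car] simp del: index_mult_mat(1) intro!: hord_ge_sum)
qed

lemma GL_integral_iff:
  "U \<in> GL_integral n \<longleftrightarrow> U \<in> integral_mat n \<and>
     (\<exists>V \<in> integral_mat n. U * V = 1\<^sub>m n \<and> V * U = 1\<^sub>m n)"
proof -
  have "dim_row U = n" if "U \<in> integral_mat n" for U :: "'a mat"
    using that by (auto simp: integral_mat_iff)
  then show ?thesis unfolding GL_integral_def inverts_mat_def by auto
qed

lemma GL_integral_carrier: "U \<in> GL_integral n \<Longrightarrow> U \<in> carrier_mat n n"
  by (simp add: GL_integral_iff integral_mat_iff)

lemma one_integral_mat [simp]: "1\<^sub>m n \<in> integral_mat n"
  by (auto simp: integral_mat_iff one_mat_def)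

lemma one_GL_integral [simp]: "1\<^sub>m n \<in> GL_integral n"
  unfolding GL_integral_iff using one_integral_mat by (intro conjI bexI[of _ "1\<^sub>m n"]) auto

lemma GL_integral_mult:
  assumes U: "U \<in> GL_integral n" and V: "V \<in> GL_integral n"
  shows "U * V \<in> GL_integral n"
proof -
  obtain U' where U': "U' \<in> integral_mat n" "U * U' = 1\<^sub>m n" "U' * U = 1\<^sub>m n"
    using U by (auto simp: GL_integral_iff)
  obtain V' where V': "V' \<in> integral_mat n" "V * V' = 1\<^sub>m n" "V' * V = 1\<^sub>m n"
    using V by (auto simp: GL_integral_iff)
  have car: "U \<in> carrier_mat n n" "V \<in> carrier_mat n n" "U' \<in> carrier_mat n n" "V' \<in> carrier_mat n n"
    using U V U'(1) V'(1) by (auto simp: GL_integral_iff integral_mat_iff)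
  have "U * V * (V' * U') = U * (V * V') * U'"
    using car by (simp add: assoc_mult_mat[of _ n n _ n _ n])
  also have "\<dots> = 1\<^sub>m n" using car V' U' by simp
  finally have 1: "U * V * (V' * U') = 1\<^sub>m n" .
  have "V' * U' * (U * V) = V' * (U' * U) * V"
    using car by (simp add: assoc_mult_mat[of _ n n _ n _ n])
  also have "\<dots> = 1\<^sub>m n" using car V' U' by simp
  finally have 2: "V' * U' * (U * V) = 1\<^sub>m n" .
  show ?thesis
    unfolding GL_integral_iff using 1 2 U V U' V' integral_mat_mult
    by (auto simp: GL_integral_iff intro!: bexI[of _ "V' * U'"])
qed

lemma mat_act_carrier: "B \<in> carrier_mat n n \<Longrightarrow> U \<in> carrier_mat n n \<Longrightarrow> mat_act B U \<in> carrier_mat n n"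
  by (simp add: mat_act_def)

lemma mat_act_one: "B \<in> carrier_mat n n \<Longrightarrow> mat_act B (1\<^sub>m n) = B"
  by (simp add: mat_act_def transpose_one)

lemma mat_act_mult:
  assumes "B \<in> carrier_mat n n" "U \<in> carrier_mat n n" "V \<in> carrier_mat n n"
  shows "mat_act (mat_act B U) V = mat_act B (U * V)"
  using assms by (simp add: mat_act_def transpose_mult[of _ n n _ n] assoc_mult_mat[of _ n n _ n _ n])

text \<open>One bound covers all index pairs: for equal values it is integrality, and for
  \<open>a ! i > a ! j\<close> it holds because the entry is 0. In this form the bounds telescope
  under matrix products.\<close>

lemma G_tri_iff:
  "g \<in> G_tri a \<longleftrightarrow> g \<in> GL_integral (length a) \<and> (\<forall>i<length a. \<forall>j<length a.
     hord_ge (int (a ! j) - int (a ! i)) (g $$ (i, j)) \<and> (a ! i > a ! j \<longrightarrow> g $$ (i, j) = 0))"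
proof -
  have "hord_ge (int (a ! j) - int (a ! i)) (g $$ (i, j))"
    if g: "g \<in> G_tri a" and ij: "i < length a" "j < length a" for i j
  proof (cases "a ! i" "a ! j" rule: linorder_cases)
    case less
    then show ?thesis using that by (simp add: G_tri_def G_set_def vord_ge_half_diff_iff)
  next
    case equal
    then show ?thesis using that by (simp add: G_tri_def G_set_def GL_integral_def integral_mat_iff)
  next
    case greater
    then show ?thesis using that by (simp add: G_tri_def)
  qed
  then show ?thesis
    unfolding G_tri_def G_set_def vord_ge_half_diff_iff by blast
qed

lemma G_tri_mult:
  assumes g: "g \<in> G_tri a" and h: "h \<in> G_tri a"
  shows "g * h \<in> G_tri a"
proof -
  let ?n = "length a"
  have car: "g \<in> carrier_mat ?n ?n" "h \<in> carrier_mat ?n ?n"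
    using g h by (auto simp: G_tri_iff intro: GL_integral_carrier)
  have 1: "hord_ge (int (a ! j) - int (a ! i)) ((g * h) $$ (i, j))" if "i < ?n" "j < ?n" for i j
  proof -
    have "hord_ge (int (a ! j) - int (a ! i)) (g $$ (i, k) * h $$ (k, j))" if "k < ?n" for k
      using hord_ge_mult[of "int (a ! k) - int (a ! i)" "g $$ (i, k)" "int (a ! j) - int (a ! k)" "h $$ (k, j)"]
        g h that \<open>i < ?n\<close> \<open>j < ?n\<close> by (simp add: G_tri_iff)
    then show ?thesis using that unfolding times_mat_index[OF car that] by (intro hord_ge_sum) simp
  qed
  have 2: "(g * h) $$ (i, j) = 0" if ij: "i < ?n" "j < ?n" "a ! i > a ! j" for i j
  proof -
    have "g $$ (i, k) * h $$ (k, j) = 0" if "k < ?n" for k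
      using g h that ij by (cases "a ! i > a ! k") (auto simp: G_tri_iff)
    then show ?thesis unfolding times_mat_index[OF car ij(1,2)] by (intro sum.neutral) simp
  qed
  show ?thesis
    using 1 2 g h GL_integral_mult by (auto simp: G_tri_iff)
qed

lemma one_G_tri [simp]: "1\<^sub>m (length a) \<in> G_tri a"
  by (auto simp: G_tri_iff)

definition tri_equiv :: "nat list \<Rightarrow> 'a::discretely_valued_field mat \<Rightarrow> 'a mat \<Rightarrow> bool" where
  "tri_equiv a B C \<longleftrightarrow> (\<exists>U \<in> G_tri a. C = mat_act B U)"

lemma G_tri_GL: "U \<in> G_tri a \<Longrightarrow> U \<in> GL_integral (length a)"
  by (simp add: G_tri_iff)

lemma tri_equiv_refl: "B \<in> carrier_mat (length a) (length a) \<Longrightarrow> tri_equiv a B B"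
  unfolding tri_equiv_def by (rule bexI[OF _ one_G_tri]) (simp add: mat_act_one)

lemma tri_equiv_trans:
  assumes B: "B \<in> carrier_mat (length a) (length a)" and "tri_equiv a B C" "tri_equiv a C D"
  shows "tri_equiv a B D"
proof -
  obtain U where U: "U \<in> G_tri a" "C = mat_act B U" using assms by (auto simp: tri_equiv_def)
  obtain V where V: "V \<in> G_tri a" "D = mat_act C V" using assms by (auto simp: tri_equiv_def)
  have "D = mat_act B (U * V)"
    unfolding V(2) U(2) using mat_act_mult[OF B] U V G_tri_GL GL_integral_carrier by blast
  then show ?thesis unfolding tri_equiv_def using G_tri_mult U V by blast
qed

text \<open>Basis vector \<open>j\<close> is replaced by itself plus \<open>t\<close> times basis
  vector \<open>i\<close>. The bound on \<open>t\<close> is the one that \<open>G_tri\<close>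
  imposes on the entry \<open>(i, j)\<close>, and it keeps every term of the new row above its bound
  in \<open>M_set\<close>. The cross term of the diagonal entry is written with
  \<open>2 * C $$ (i, j)\<close>, since it is the doubled entry that \<open>M_set\<close>
  bounds.\<close>

lemma tri_equiv_add:
  assumes C: "C \<in> M_set a" and i: "i < length a" and j: "j < length a" and ij: "i \<noteq> j"
    and le: "a ! i \<le> a ! j" and t: "hord_ge (int (a ! j) - int (a ! i)) t"
  obtains D where "tri_equiv a C D" "D \<in> M_set a"
    "D $$ (j, j) = C $$ (j, j) + t * (2 * C $$ (i, j)) + t * t * C $$ (i, i)"
    "\<And>k. k < length a \<Longrightarrow> k \<noteq> j \<Longrightarrow> D $$ (j, k) = C $$ (j, k) + t * C $$ (i, k)"
    "\<And>k l. k < length a \<Longrightarrow> l < length a \<Longrightarrow> k \<noteq> j \<Longrightarrow> l \<noteq> j \<Longrightarrow> D $$ (k, l) = C $$ (k, l)"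
proof -
  let ?n = "length a"
  let ?E = "\<lambda>t. addrow_mat ?n t i j"
  define D where "D = addrow t j i (addcol t j i C)"
  have car: "C \<in> carrier_mat ?n ?n" using C by (rule M_set_carrier)
  have t0: "hord_ge 0 t" using t by (rule hord_ge_mono) (use le in simp)
  have int: "?E s \<in> integral_mat ?n" if "hord_ge 0 s" for s
    using that ij by (auto simp: integral_mat_iff addrow_mat_def)
  have inv: "?E t * ?E (- t) = 1\<^sub>m ?n" "?E (- t) * ?E t = 1\<^sub>m ?n"
    using addrow_mat_inv[OF i j ij, of t] addrow_mat_inv[OF i j ij, of "- t"] by simp_all
  have GL: "?E t \<in> GL_integral ?n"
    unfolding GL_integral_iff using int[of t] int[of "- t"] inv t0 by auto
  have G: "?E t \<in> G_tri a"
    using GL t le ij by (auto simp: G_tri_iff)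
  have tr: "transpose_mat (?E t) = addrow_mat ?n t j i"
    by (rule eq_matI) auto
  have "mat_act C (?E t) = addrow_mat ?n t j i * (C * ?E t)"
    unfolding mat_act_def tr using car by (simp add: assoc_mult_mat[of _ ?n ?n _ ?n _ ?n])
  also have "C * ?E t = addcol t j i C" by (rule addcol_mat[OF car i, symmetric])
  also have "addrow_mat ?n t j i * addcol t j i C = D"
    unfolding D_def by (rule addrow_mat[symmetric, OF _ i, of _ ?n]) (use car in auto)
  finally have eq: "tri_equiv a C D" unfolding tri_equiv_def using G by auto
  have sym: "C $$ (k, l) = C $$ (l, k)" if "k < ?n" "l < ?n" for k l
    using M_setD(1)[OF C that] .
  have jj: "D $$ (j, j) = C $$ (j, j) + t * (2 * C $$ (i, j)) + t * t * C $$ (i, i)"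
    using car i j ij sym[OF j i] by (simp add: D_def algebra_simps)
  have jk: "D $$ (j, k) = C $$ (j, k) + t * C $$ (i, k)" "D $$ (k, j) = C $$ (j, k) + t * C $$ (i, k)"
    if "k < ?n" "k \<noteq> j" for k
    using car i j ij that sym[OF j, of k] sym[OF i, of k] by (auto simp: D_def)
  have kl: "D $$ (k, l) = C $$ (k, l)" if "k < ?n" "l < ?n" "k \<noteq> j" "l \<noteq> j" for k l
    using car that by (simp add: D_def)
  have "D \<in> carrier_mat ?n ?n" using car by (auto simp: D_def)
  moreover have "D $$ (k, l) = D $$ (l, k)" if "k < ?n" "l < ?n" for k l
    using that jk kl sym by (cases "k = j"; cases "l = j") auto
  moreover have "hord_ge (2 * int (a ! k)) (D $$ (k, k))" if k: "k < ?n" for k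
  proof (cases "k = j")
    case True
    have "hord_ge ((int (a ! j) - int (a ! i)) + (int (a ! i) + int (a ! j))) (t * (2 * C $$ (i, j)))"
      using t M_setD(3)[OF C i j ij] by (rule hord_ge_mult)
    moreover have "hord_ge ((int (a ! j) - int (a ! i)) + (int (a ! j) - int (a ! i)) + 2 * int (a ! i))
        (t * t * C $$ (i, i))"
      using t M_setD(2)[OF C i i] by (intro hord_ge_mult)
    ultimately show ?thesis
      unfolding True jj using M_setD(2)[OF C j j] by (intro hord_ge_add) simp_all
  next
    case False
    then show ?thesis using kl[OF k k] M_setD(2)[OF C k k] by simp
  qed
  moreover have jk_ge: "hord_ge (int (a ! j) + int (a ! k)) (2 * D $$ (j, k))" if k: "k < ?n" "k \<noteq> j" for k
  proof -
    have "hord_ge (int (a ! i) + int (a ! k)) (2 * C $$ (i, k))"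
    proof (cases "k = i")
      case True
      then show ?thesis using hord_ge_mult[OF hord_ge_two M_setD(2)[OF C i i]] by simp
    next
      case False
      then show ?thesis using M_setD(3)[OF C i k(1)] by simp
    qed
    from hord_ge_mult[OF t this] have "hord_ge (int (a ! j) + int (a ! k)) (t * (2 * C $$ (i, k)))"
      by simp
    with M_setD(3)[OF C j k(1)] k(2)
    have "hord_ge (int (a ! j) + int (a ! k)) (2 * C $$ (j, k) + t * (2 * C $$ (i, k)))"
      by (intro hord_ge_add) auto
    then show ?thesis unfolding jk(1)[OF k] by (simp add: algebra_simps)
  qed
  moreover have "hord_ge (int (a ! k) + int (a ! l)) (2 * D $$ (k, l))"
    if "k < ?n" "l < ?n" "k \<noteq> l" for k l
  proof -
    consider "k = j" | "l = j" | "k \<noteq> j" "l \<noteq> j" by blast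
    then show ?thesis
    proof cases
      case 1
      then show ?thesis using jk_ge that by simp
    next
      case 2
      then show ?thesis using jk_ge[of k] jk[of k] that by (simp add: add.commute)
    next
      case 3
      then show ?thesis using that kl M_setD(3)[OF C] by simp
    qed
  qed
  ultimately have "D \<in> M_set a" unfolding M_set_iff by blast
  with eq jj jk(1) kl that show thesis by blast
qed

text \<open>Indices of one block carry the same bounds, so exchanging them costs nothing. This is
  used to move an index to the end of its block or to the front of the unprocessed part.\<close>

lemma tri_equiv_swap:
  assumes C: "C \<in> M_set a" and i: "i < length a" and j: "j < length a" and eq: "a ! i = a ! j"
  obtains D where "tri_equiv a C D" "D \<in> M_set a"
    "\<And>k l. k < length a \<Longrightarrow> l < length a \<Longrightarrow> D $$ (k, l) = C $$ (transpose i j k, transpose i j l)"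
proof -
  let ?n = "length a"
  let ?E = "swaprows_mat ?n i j"
  define D where "D = swaprows i j (swapcols i j C)"
  have car: "C \<in> carrier_mat ?n ?n" using C by (rule M_set_carrier)
  have "?E \<in> integral_mat ?n"
    by (auto simp: integral_mat_iff)
  then have GL: "?E \<in> GL_integral ?n"
    unfolding GL_integral_iff using swaprows_mat_inv[OF i j] by auto
  have G: "?E \<in> G_tri a"
    using GL eq by (auto simp: G_tri_iff)
  have tr: "transpose_mat ?E = ?E"
    by (rule eq_matI) auto
  have "mat_act C ?E = ?E * (C * ?E)"
    unfolding mat_act_def tr using car by (simp add: assoc_mult_mat[of _ ?n ?n _ ?n _ ?n])
  also have "C * ?E = swapcols i j C" by (rule swapcols_mat[OF car i j, symmetric])
  also have "?E * swapcols i j C = D"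
    unfolding D_def by (rule swaprows_mat[symmetric, OF _ i j, of _ ?n]) (use car in auto)
  finally have 1: "tri_equiv a C D" unfolding tri_equiv_def using G by auto
  have idx: "D $$ (k, l) = C $$ (transpose i j k, transpose i j l)" if "k < ?n" "l < ?n" for k l
    using car i j that by (auto simp: D_def transpose_def)
  have tr_less: "transpose i j k < ?n" if "k < ?n" for k
    using that i j by (simp add: transpose_def)
  have a_tr: "a ! transpose i j k = a ! k" for k
    using eq by (simp add: transpose_def)
  have "D \<in> carrier_mat ?n ?n" using car by (auto simp: D_def)
  moreover have "D $$ (k, l) = D $$ (l, k)" if "k < ?n" "l < ?n" for k l
    using that M_setD(1)[OF C] by (simp add: idx tr_less)
  moreover have "hord_ge (2 * int (a ! k)) (D $$ (k, k))" if "k < ?n" for k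
    using that M_setD(2)[OF C tr_less tr_less] by (simp add: idx a_tr)
  moreover have "hord_ge (int (a ! k) + int (a ! l)) (2 * D $$ (k, l))"
    if "k < ?n" "l < ?n" "k \<noteq> l" for k l
  proof -
    have "transpose i j k \<noteq> transpose i j l" using that(3) by (metis transpose_involutory)
    then show ?thesis using that M_setD(3)[OF C tr_less tr_less, of k l] by (simp add: idx a_tr)
  qed
  ultimately have 2: "D \<in> M_set a" unfolding M_set_iff by blast
  from 1 2 idx that show thesis by blast
qed

section \<open>Clearing a matched pair\<close>

text \<open>\<open>linked\<close> and \<open>exact\<close> say that an entry attains the bound imposed by \<open>M_set a\<close>, so that it
  survives in the graded quadratic form over the residue field.\<close>

definition linked :: "nat list \<Rightarrow> 'a::discretely_valued_field mat \<Rightarrow> nat \<Rightarrow> nat \<Rightarrow> bool" where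
  "linked a C i j \<longleftrightarrow> \<not> hord_ge (int (a ! i) + int (a ! j) + 1) (2 * C $$ (i, j))"

definition exact :: "nat list \<Rightarrow> 'a::discretely_valued_field mat \<Rightarrow> nat \<Rightarrow> bool" where
  "exact a C i \<longleftrightarrow> \<not> hord_ge (2 * int (a ! i) + 1) (C $$ (i, i))"

lemma linked_sym:
  "C \<in> M_set a \<Longrightarrow> i < length a \<Longrightarrow> j < length a \<Longrightarrow> linked a C i j \<longleftrightarrow> linked a C j i"
  using M_setD(1)[of C a i j] by (simp add: linked_def add.commute)

text \<open>The bound concerns a doubled order, so it is attained only if it is even. Links never
  join the residue forms of the two parities.\<close>

lemma linked_parity:
  assumes "C \<in> M_set a" "i < length a" "j < length a" "i \<noteq> j" "linked a C i j"
  shows "even (a ! i + a ! j)"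
  using hord_ge_odd[OF M_setD(3)[OF assms(1-4)]] assms(5) unfolding linked_def by auto

lemma linked_cong:
  "D $$ (i, j) = C $$ (i, j) \<Longrightarrow> linked a D i j \<longleftrightarrow> linked a C i j"
  by (simp add: linked_def)

lemma exact_cong:
  "D $$ (i, i) = C $$ (i, i) \<Longrightarrow> exact a D i \<longleftrightarrow> exact a C i"
  by (simp add: exact_def)

text \<open>A linked pair spans a nonsingular plane of the residue form, and vector \<open>k\<close>
  is made orthogonal to it. Instead of solving a 2 x 2 system, a multiple of \<open>j\<close>
  removes the entry with \<open>i\<close> and then a multiple of \<open>i\<close> removes the entry
  with \<open>j\<close>, which works because the plane is alternating modulo 2. The last conclusion
  protects the links between \<open>k\<close> and the fixed points that still wait for a
  partner.\<close>

lemma clear_index: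
  fixes C :: "'a::discretely_valued_field mat"
  assumes two: "hord_ge 1 (2::'a)" and C: "C \<in> M_set a"
    and i: "i < length a" and j: "j < length a" and k: "k < length a"
    and ne: "i \<noteq> j" "k \<noteq> i" "k \<noteq> j" and le: "a ! i \<le> a ! k" "a ! j \<le> a ! k"
    and ij: "linked a C i j"
  obtains D where "tri_equiv a C D" "D \<in> M_set a" "\<not> linked a D i k" "\<not> linked a D j k"
    "\<And>p q. p < length a \<Longrightarrow> q < length a \<Longrightarrow> p \<noteq> k \<Longrightarrow> q \<noteq> k \<Longrightarrow> D $$ (p, q) = C $$ (p, q)"
    "\<And>z. z < length a \<Longrightarrow> z \<noteq> i \<Longrightarrow> z \<noteq> j \<Longrightarrow> z \<noteq> k \<Longrightarrow> \<not> linked a C i z \<Longrightarrow> \<not> linked a C j z \<Longrightarrow>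
      linked a D k z \<longleftrightarrow> linked a C k z"
proof -
  have nz: "2 * C $$ (i, j) \<noteq> 0" using ij by (auto simp: linked_def)
  then have nz': "C $$ (i, j) \<noteq> 0" by auto
  \<comment> \<open>Both entries are doubled so that the bounds apply directly: the numerator has
    doubled order at least \<open>a ! k + a ! i\<close> and the denominator at most
    \<open>a ! i + a ! j\<close>, which leaves what adding \<open>j\<close> to \<open>k\<close>
    requires.\<close>
  define t where "t = - ((2 * C $$ (k, i)) / (2 * C $$ (i, j)))"
  have t: "hord_ge (int (a ! k) - int (a ! j)) t"
    using hord_ge_divide[OF M_setD(3)[OF C k i ne(2)] ij[unfolded linked_def]] by (simp add: t_def)
  obtain D where D: "tri_equiv a C D" "D \<in> M_set a"
    "\<And>l. l < length a \<Longrightarrow> l \<noteq> k \<Longrightarrow> D $$ (k, l) = C $$ (k, l) + t * C $$ (j, l)"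
    "\<And>p q. p < length a \<Longrightarrow> q < length a \<Longrightarrow> p \<noteq> k \<Longrightarrow> q \<noteq> k \<Longrightarrow> D $$ (p, q) = C $$ (p, q)"
    using tri_equiv_add[OF C j k ne(3)[symmetric] le(2) t] by metis
  have ji: "C $$ (j, i) = C $$ (i, j)" using M_setD(1)[OF C i j] by simp
  have ki: "D $$ (k, i) = 0"
    using D(3)[OF i ne(2)[symmetric]] nz' by (simp add: ji t_def)
  define s where "s = - ((2 * D $$ (k, j)) / (2 * D $$ (i, j)))"
  have Dij: "D $$ (i, j) = C $$ (i, j)" using D(4) i j ne by simp
  then have ijD: "linked a D i j" using ij linked_cong by blast
  have s: "hord_ge (int (a ! k) - int (a ! i)) s"
    using hord_ge_divide[OF M_setD(3)[OF D(2) k j ne(3)]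
        ijD[unfolded linked_def, unfolded add.commute[of "int (a ! i)"]]]
    by (simp add: s_def)
  obtain E where E: "tri_equiv a D E" "E \<in> M_set a"
    "\<And>l. l < length a \<Longrightarrow> l \<noteq> k \<Longrightarrow> E $$ (k, l) = D $$ (k, l) + s * D $$ (i, l)"
    "\<And>p q. p < length a \<Longrightarrow> q < length a \<Longrightarrow> p \<noteq> k \<Longrightarrow> q \<noteq> k \<Longrightarrow> E $$ (p, q) = D $$ (p, q)"
    using tri_equiv_add[OF D(2) i k ne(2)[symmetric] le(1) s] by metis
  have "E $$ (k, j) = 0"
    using E(3)[OF j ne(3)[symmetric]] nz' by (simp add: Dij s_def)
  then have kj: "\<not> linked a E k j" by (simp add: linked_def)
  \<comment> \<open>The second addition spoils the entry \<open>(k, i)\<close> only by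
    \<open>s * D $$ (i, i)\<close>. Doubling it brings in the positive order of 2, which lifts it
    strictly above the bound.\<close>
  have "hord_ge (1 + ((int (a ! k) - int (a ! i)) + 2 * int (a ! i))) (2 * (s * D $$ (i, i)))"
    by (intro hord_ge_mult two s M_setD(2)[OF D(2) i i])
  moreover have "E $$ (k, i) = s * D $$ (i, i)"
    using E(3)[OF i ne(2)[symmetric]] ki by simp
  ultimately have ki': "\<not> linked a E k i" by (simp add: linked_def add_ac)
  \<comment> \<open>A multiple of a row that is unlinked at \<open>z\<close> changes the entry at
    \<open>z\<close> only strictly above its bound.\<close>
  have shift: "linked a Y k z \<longleftrightarrow> linked a X k z"
    if "Y $$ (k, z) = X $$ (k, z) + u * X $$ (p, z)" "\<not> linked a X p z"
      "hord_ge (int (a ! k) - int (a ! p)) u" for X Y :: "'a mat" and u p z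
  proof -
    have "hord_ge (int (a ! k) - int (a ! p) + (int (a ! p) + int (a ! z) + 1)) (u * (2 * X $$ (p, z)))"
      by (rule hord_ge_mult[OF that(3) that(2)[unfolded linked_def not_not]])
    then have "hord_ge (int (a ! k) + int (a ! z) + 1) (u * (2 * X $$ (p, z)))"
      by (rule hord_ge_mono) simp
    from hord_ge_add_cancel[OF this, of "2 * X $$ (k, z)"] show ?thesis
      unfolding linked_def that(1) by (simp add: algebra_simps)
  qed
  have "linked a E k z \<longleftrightarrow> linked a C k z"
    if z: "z < length a" "z \<noteq> i" "z \<noteq> j" "z \<noteq> k" "\<not> linked a C i z" "\<not> linked a C j z" for z
  proof -
    have "linked a E k z \<longleftrightarrow> linked a D k z"
      using shift[OF E(3)[OF z(1,4)] _ s] D(4)[OF i z(1)] ne z linked_cong by metis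
    also have "\<dots> \<longleftrightarrow> linked a C k z"
      by (rule shift[OF D(3)[OF z(1,4)] z(6) t])
    finally show ?thesis .
  qed
  moreover have "tri_equiv a C E"
    using tri_equiv_trans[OF M_set_carrier[OF C] D(1) E(1)] .
  moreover have "\<not> linked a E i k" "\<not> linked a E j k"
    using ki' kj linked_sym[OF E(2)] i j k by blast+
  ultimately show thesis using that[of E] E(2,4) D(4) by simp
qed

text \<open>Clearing one more index changes only its own row and column, so the indices cleared
  before stay cleared and the pair stays linked.\<close>

lemma clear_set:
  fixes C :: "'a::discretely_valued_field mat"
  assumes two: "hord_ge 1 (2::'a)" and C: "C \<in> M_set a"
    and i: "i < length a" and j: "j < length a" and ne: "i \<noteq> j" and ij: "linked a C i j"
    and "finite K" and "\<forall>k\<in>K. k < length a \<and> k \<noteq> i \<and> k \<noteq> j \<and> a ! i \<le> a ! k \<and> a ! j \<le> a ! k"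
  shows "\<exists>D. tri_equiv a C D \<and> D \<in> M_set a \<and>
    (\<forall>k\<in>K. \<not> linked a D i k \<and> \<not> linked a D j k) \<and>
    (\<forall>p q. p < length a \<longrightarrow> q < length a \<longrightarrow> p \<notin> K \<longrightarrow> q \<notin> K \<longrightarrow> D $$ (p, q) = C $$ (p, q)) \<and>
    (\<forall>z k. z < length a \<longrightarrow> z \<noteq> i \<longrightarrow> z \<noteq> j \<longrightarrow> z \<notin> K \<longrightarrow> \<not> linked a C i z \<longrightarrow> \<not> linked a C j z \<longrightarrow>
      k \<in> K \<longrightarrow> (linked a D k z \<longleftrightarrow> linked a C k z))"
  using assms(7,8)
proof (induction K rule: finite_induct)
  case empty
  show ?case using tri_equiv_refl[OF M_set_carrier[OF C]] C by blast
next
  case (insert k K)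
  then obtain D where D: "tri_equiv a C D" "D \<in> M_set a"
    "\<And>k. k \<in> K \<Longrightarrow> \<not> linked a D i k \<and> \<not> linked a D j k"
    "\<And>p q. p < length a \<Longrightarrow> q < length a \<Longrightarrow> p \<notin> K \<Longrightarrow> q \<notin> K \<Longrightarrow> D $$ (p, q) = C $$ (p, q)"
    "\<And>z k. z < length a \<Longrightarrow> z \<noteq> i \<Longrightarrow> z \<noteq> j \<Longrightarrow> z \<notin> K \<Longrightarrow> \<not> linked a C i z \<Longrightarrow> \<not> linked a C j z \<Longrightarrow>
      k \<in> K \<Longrightarrow> (linked a D k z \<longleftrightarrow> linked a C k z)"
    by (smt (verit) insertCI)
  have k: "k < length a" "k \<noteq> i" "k \<noteq> j" "a ! i \<le> a ! k" "a ! j \<le> a ! k"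
    using insert.prems by auto
  have K: "i \<notin> K" "j \<notin> K" "\<And>k. k \<in> K \<Longrightarrow> k < length a"
    using insert.prems by blast+
  have "linked a D i j" using ij D(4)[OF i j K(1,2)] linked_cong by blast
  then obtain E where E: "tri_equiv a D E" "E \<in> M_set a" "\<not> linked a E i k" "\<not> linked a E j k"
    "\<And>p q. p < length a \<Longrightarrow> q < length a \<Longrightarrow> p \<noteq> k \<Longrightarrow> q \<noteq> k \<Longrightarrow> E $$ (p, q) = D $$ (p, q)"
    "\<And>z. z < length a \<Longrightarrow> z \<noteq> i \<Longrightarrow> z \<noteq> j \<Longrightarrow> z \<noteq> k \<Longrightarrow> \<not> linked a D i z \<Longrightarrow> \<not> linked a D j z \<Longrightarrow>
      linked a E k z \<longleftrightarrow> linked a D k z"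
    using clear_index[OF two D(2) i j k(1) ne k(2,3,4,5)] by metis
  have 1: "tri_equiv a C E" using tri_equiv_trans[OF M_set_carrier[OF C] D(1) E(1)] .
  have 2: "\<not> linked a E i m \<and> \<not> linked a E j m" if "m \<in> insert k K" for m
    using that E(3-5) D(3) K i j k insert.hyps linked_cong by (metis insertE)
  have 3: "E $$ (p, q) = C $$ (p, q)"
    if "p < length a" "q < length a" "p \<notin> insert k K" "q \<notin> insert k K" for p q
    using that D(4) E(5) by simp
  have 4: "linked a E m z \<longleftrightarrow> linked a C m z"
    if z: "z < length a" "z \<noteq> i" "z \<noteq> j" "z \<notin> insert k K" "\<not> linked a C i z" "\<not> linked a C j z"
      and m: "m \<in> insert k K" for z m
  proof (cases "m = k")
    case True
    have "\<not> linked a D i z" "\<not> linked a D j z"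
      using z D(4)[OF i z(1)] D(4)[OF j z(1)] K linked_cong by (metis insertI2)+
    then have "linked a E k z \<longleftrightarrow> linked a D k z" using E(6) z by blast
    also have "\<dots> \<longleftrightarrow> linked a C k z"
      using linked_cong[OF D(4)[OF k(1) z(1) insert.hyps(2)]] z by blast
    finally show ?thesis using True by simp
  next
    case False
    then have "m \<in> K" using m by blast
    then show ?thesis using D(5) E(5) z K(3) False linked_cong by (metis insertCI)
  qed
  show ?case using 1 2 3 4 E(2) by blast
qed

section \<open>Consequences of maximality\<close>

text \<open>The upper-bound half of \<open>is_GK\<close>. The other half is tracked separately as
  membership of the current matrix in \<open>M_set a\<close>, which a general change of basis need
  not preserve.\<close>

definition maximal_for :: "nat list \<Rightarrow> 'a::discretely_valued_field mat \<Rightarrow> bool" where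
  "maximal_for a C \<longleftrightarrow>
     (\<forall>U \<in> GL_integral (length a). \<forall>b \<in> S_set (mat_act C U). b = a \<or> (b, a) \<in> lex less_than)"

lemma maximal_for_equiv:
  assumes B: "B \<in> carrier_mat (length a) (length a)" and max: "maximal_for a B"
    and U: "U \<in> GL_integral (length a)"
  shows "maximal_for a (mat_act B U)"
proof -
  have "mat_act (mat_act B U) V = mat_act B (U * V)" "U * V \<in> GL_integral (length a)"
    if "V \<in> GL_integral (length a)" for V
    using mat_act_mult[OF B] GL_integral_carrier GL_integral_mult U that by blast+
  then show ?thesis using max unfolding maximal_for_def by metis
qed

lemma maximal_for_tri_equiv:
  assumes "B \<in> carrier_mat (length a) (length a)" "maximal_for a B" "tri_equiv a B C"
  shows "maximal_for a C"
  using assms maximal_for_equiv G_tri_GL unfolding tri_equiv_def by blast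

lemma lex_less_than_first_difference:
  assumes "(b, a) \<in> lex less_than" "m < length a"
    and "\<And>j. j < m \<Longrightarrow> b ! j = a ! j" "a ! m < b ! m"
  shows False
proof -
  from assms(1) have len: "length b = length a"
    by (auto simp: lex_conv)
  from assms(1) obtain xs x xs' y ys' where b: "b = xs @ x # xs'" and a: "a = xs @ y # ys'" and "x < y"
    by (auto simp: lex_conv)
  have "b ! length xs < a ! length xs" using \<open>x < y\<close> by (simp add: a b)
  moreover have "b ! j = a ! j" if "j < length xs" for j
    using that by (simp add: a b nth_append)
  ultimately show False
    using assms(3)[of "length xs"] assms(3)[of m] assms(4)
    by (metis less_irrefl less_asym linorder_neqE_nat)
qed

text \<open>Raising \<open>a ! m\<close> by one and lowering every entry exceeding \<open>a ! m + 1\<close> by one keeps the list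
  sorted, increases it lexicographically and preserves membership in \<open>M_set\<close>.\<close>

lemma maximal_for_exact_or_linked_last:
  assumes sorted: "sorted a" and C: "C \<in> M_set a" and max: "maximal_for a C"
    and m: "m < length a" and last: "\<And>j. m < j \<Longrightarrow> j < length a \<Longrightarrow> a ! m < a ! j"
    and exact: "\<not> exact a C m"
    and unlinked: "\<And>j. j < length a \<Longrightarrow> j \<noteq> m \<Longrightarrow> a ! j \<le> a ! m \<Longrightarrow> \<not> linked a C m j"
  shows False
proof -
  define g where "g j = (if j = m then a ! m + 1 else if a ! j \<le> a ! m + 1 then a ! j else a ! j - 1)" for j
  define b where "b = map g [0..<length a]"
  have len: "length b = length a" by (simp add: b_def)
  have nth: "b ! j = g j" if "j < length a" for j using that by (simp add: b_def)
  have low: "a ! j \<le> a ! m" if "j < m" for j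
    using sorted_nth_mono[OF sorted] that m by simp
  \<comment> \<open>By \<open>last\<close>, the entries after \<open>m\<close> are at least
    \<open>a ! m + 1\<close>, and only those above that value are lowered, so none drops below the
    raised entry.\<close>
  have "g i \<le> g j" if "i \<le> j" "j < length a" for i j
    using sorted_nth_mono[OF sorted that] low[of i] low[of j] last[of i] last[of j] that
    by (cases i m rule: linorder_cases; cases j m rule: linorder_cases) (auto simp: g_def)
  then have "sorted b" by (simp add: sorted_iff_nth_mono len nth)
  \<comment> \<open>Inexactness yields one doubled unit; parity supplies the second one, which makes
    up the full unit by which \<open>a ! m\<close> is raised.\<close>
  have exact': "hord_ge (2 * int (a ! m) + 2) (C $$ (m, m))"
    using hord_ge_odd[OF exact[unfolded exact_def not_not]] by (simp add: add_ac)
  have off_m: "hord_ge (int (g m) + int (g j)) (2 * C $$ (m, j))" if j: "j < length a" "j \<noteq> m" for j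
  proof -
    note ge = M_setD(3)[OF C m j(1) j(2)[symmetric]]
    \<comment> \<open>The sum of the two values rises in the first two cases only. Missing links pay
      for it up to \<open>a ! m\<close>, and parity pays for it at \<open>a ! m + 1\<close>, where
      the old sum is odd. Beyond that, raising one value and lowering the other cancel.\<close>
    consider "a ! j \<le> a ! m" | "a ! j = a ! m + 1" | "a ! j > a ! m + 1" by linarith
    then show ?thesis
    proof cases
      case 1
      then have "\<not> linked a C m j" using unlinked j by blast
      then show ?thesis using 1 j by (simp add: linked_def g_def add_ac)
    next
      case 2
      then show ?thesis using hord_ge_odd[OF ge] j by (simp add: g_def add_ac)
    next
      case 3
      then show ?thesis using ge j by (simp add: g_def of_nat_diff add_ac)
    qed
  qed
  have "hord_ge (2 * int (g i)) (C $$ (i, i))" if "i < length a" for i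
  proof (cases "i = m")
    case True
    show ?thesis unfolding True g_def by (rule hord_ge_mono[OF exact']) simp
  next
    case False
    then show ?thesis by (intro hord_ge_mono[OF M_setD(2)[OF C that that]]) (auto simp: g_def)
  qed
  moreover have "hord_ge (int (g i) + int (g j)) (2 * C $$ (i, j))"
    if ij: "i < length a" "j < length a" "i \<noteq> j" for i j
  proof -
    consider "i = m" | "j = m" | "i \<noteq> m" "j \<noteq> m" by blast
    then show ?thesis
    proof cases
      case 1
      then show ?thesis using off_m ij by simp
    next
      case 2
      then show ?thesis using off_m[of i] ij M_setD(1)[OF C m, of i] by (simp add: add.commute)
    next
      case 3
      then show ?thesis by (intro hord_ge_mono[OF M_setD(3)[OF C ij]]) (auto simp: g_def)
    qed
  qed
  ultimately have "C \<in> M_set b"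
    using C by (auto simp: M_set_iff len nth)
  then have "b \<in> S_set (mat_act C (1\<^sub>m (length a)))"
    using \<open>sorted b\<close> by (simp add: S_set_def mat_act_one[OF M_set_carrier[OF C]])
  then have "b = a \<or> (b, a) \<in> lex less_than"
    using max one_GL_integral unfolding maximal_for_def by blast
  moreover have b_m: "a ! m < b ! m" using nth[OF m] by (simp add: g_def)
  moreover have "b ! j = a ! j" if "j < m" for j
    using nth[of j] that m low[OF that] by (simp add: g_def)
  ultimately show False using lex_less_than_first_difference[of b a m] m by auto
qed

text \<open>The index is exchanged with the last one of its block, since raising a value keeps the
  list sorted only there.\<close>

lemma maximal_for_exact_or_linked:
  assumes sorted: "sorted a" and C: "C \<in> M_set a" and max: "maximal_for a C"
    and i: "i < length a" and exact: "\<not> exact a C i"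
    and unlinked: "\<And>j. j < length a \<Longrightarrow> j \<noteq> i \<Longrightarrow> a ! j \<le> a ! i \<Longrightarrow> \<not> linked a C i j"
  shows False
proof -
  define m where "m = Max {j. j < length a \<and> a ! j = a ! i}"
  have fin: "finite {j. j < length a \<and> a ! j = a ! i}" by simp
  have "m \<in> {j. j < length a \<and> a ! j = a ! i}"
    unfolding m_def using i by (intro Max_in) auto
  then have m: "m < length a" "a ! m = a ! i" by auto
  have last: "a ! m < a ! j" if "m < j" "j < length a" for j
  proof -
    have "a ! j \<noteq> a ! i" using that Max_ge[OF fin, of j] unfolding m_def[symmetric] by auto
    then show ?thesis using sorted_nth_mono[OF sorted, of m j] that m by simp
  qed
  obtain D where D: "tri_equiv a C D" "D \<in> M_set a"
    "\<And>k l. k < length a \<Longrightarrow> l < length a \<Longrightarrow> D $$ (k, l) = C $$ (transpose i m k, transpose i m l)"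
    using tri_equiv_swap[OF C i m(1) m(2)[symmetric]] by metis
  have a_tr: "a ! transpose i m k = a ! k" "k < length a \<Longrightarrow> transpose i m k < length a" for k
    using m i by (simp_all add: transpose_def)
  have linked_D: "linked a D k l \<longleftrightarrow> linked a C (transpose i m k) (transpose i m l)"
    if "k < length a" "l < length a" for k l
    using that by (simp add: linked_def D(3) a_tr)
  show False
  proof (rule maximal_for_exact_or_linked_last[OF sorted D(2) _ m(1) last])
    show "maximal_for a D"
      by (rule maximal_for_tri_equiv[OF M_set_carrier[OF C] max D(1)])
    show "\<not> exact a D m"
      using exact m D(3)[OF m(1) m(1)] by (simp add: exact_def)
    fix j assume j: "j < length a" "j \<noteq> m" "a ! j \<le> a ! m"
    have "transpose i m j \<noteq> i" using j(2) by (auto simp: transpose_def)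
    then show "\<not> linked a D m j"
      using unlinked[of "transpose i m j"] j m a_tr by (simp add: linked_D)
  qed
qed

text \<open>Two orthogonal diagonal entries of the same parity merge into a single square over the perfect
  residue field, so that one of them can be made inexact.\<close>

lemma maximal_for_orthogonal_parity:
  fixes C :: "'a::nonarch_local_field mat"
  assumes two: "hord_ge 1 (2::'a)" and sorted: "sorted a" and C: "C \<in> M_set a"
    and max: "maximal_for a C" and x: "x < length a" and y: "y < length a" and ne: "x \<noteq> y"
    and le: "a ! x \<le> a ! y" and parity: "even (a ! x + a ! y)" and exact: "exact a C x"
    and ux: "\<And>j. j < length a \<Longrightarrow> j \<noteq> x \<Longrightarrow> a ! j \<le> a ! y \<Longrightarrow> \<not> linked a C x j"
    and uy: "\<And>j. j < length a \<Longrightarrow> j \<noteq> y \<Longrightarrow> a ! j \<le> a ! y \<Longrightarrow> \<not> linked a C y j"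
  shows False
proof -
  obtain d where d: "a ! y = a ! x + 2 * d"
    using le parity by (metis dvd_add_right_iff dvd_def even_add le_add_diff_inverse)
  obtain p :: 'a where "vord p = 1" using vord_normalized by blast
  then have p: "hord_ge 2 p" "\<not> hord_ge 3 p"
    using vord_eq_iff[of p 1] by (simp_all add: one_ereal_def)
  \<comment> \<open>By parity \<open>d\<close> is the integer \<open>(a ! y - a ! x) / 2\<close>, so
    \<open>p ^ d\<close> has exactly the least order allowed for a multiple of \<open>x\<close>
    added to \<open>y\<close>.\<close>
  have pd: "hord_ge (2 * int d) (p ^ d)" "\<not> hord_ge (2 * int d + 1) (p ^ d)"
  proof (induction d)
    case 0
    show "hord_ge (2 * int 0) (p ^ 0)" "\<not> hord_ge (2 * int 0 + 1) (p ^ 0)"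
      by (simp_all add: hord_ge_def zero_ereal_def)
  next
    case (Suc d)
    show "hord_ge (2 * int (Suc d)) (p ^ Suc d)"
      using hord_ge_mult[OF p(1) Suc(1)] by simp
    show "\<not> hord_ge (2 * int (Suc d) + 1) (p ^ Suc d)"
      using not_hord_ge_mult[of 2 p "2 * int d" "p ^ d"] p(2) Suc(2) by (simp add: add_ac)
  qed
  let ?x = "C $$ (x, x)" and ?y = "C $$ (y, y)"
  have xx: "hord_ge (2 * int (a ! x)) ?x" "\<not> hord_ge (2 * int (a ! x) + 1) ?x"
    using M_setD(2)[OF C x x] exact by (simp_all add: exact_def)
  have den: "\<not> hord_ge (2 * int (a ! y) + 1) (?x * (p ^ d * p ^ d))"
    using not_hord_ge_mult[OF xx(2) not_hord_ge_mult[OF pd(2) pd(2)]] d by (simp add: add_ac)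
  then have nz: "?x * (p ^ d * p ^ d) \<noteq> 0" using hord_ge_zero by metis
  \<comment> \<open>With \<open>t = s * p ^ d\<close> the sum \<open>?y + t * t * ?x\<close> equals
    \<open>?x * (p ^ d * p ^ d) * (s ^ 2 - w)\<close>, so a square root of \<open>w\<close> modulo
    the maximal ideal cancels its leading term.\<close>
  define w where "w = - (?y / (?x * (p ^ d * p ^ d)))"
  have "hord_ge 0 w"
    using hord_ge_divide[OF M_setD(2)[OF C y y] den] by (simp add: w_def)
  then obtain s where s: "hord_ge 0 s" "hord_ge 1 (s ^ 2 - w)"
    using residue_square_root[OF two] by blast
  define t where "t = s * p ^ d"
  have t: "hord_ge (int (a ! y) - int (a ! x)) t"
    using hord_ge_mult[OF s(1) pd(1)] d by (simp add: t_def)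
  obtain D where D: "tri_equiv a C D" "D \<in> M_set a"
    "D $$ (y, y) = ?y + t * (2 * C $$ (x, y)) + t * t * ?x"
    "\<And>k. k < length a \<Longrightarrow> k \<noteq> y \<Longrightarrow> D $$ (y, k) = C $$ (y, k) + t * C $$ (x, k)"
    using tri_equiv_add[OF C x y ne le t] by metis
  \<comment> \<open>Adding a multiple of \<open>x\<close> must not create links of \<open>y\<close>.
    For \<open>k = x\<close> the reason is the positive order of 2 in \<open>2 * ?x\<close>, for all
    other \<open>k\<close> it is the missing link with \<open>x\<close>.\<close>
  have shift: "hord_ge (int (a ! y) + int (a ! k) + 1) (t * (2 * C $$ (x, k)))"
    if k: "k < length a" "a ! k \<le> a ! y" for k
  proof (cases "k = x")
    case True
    have "hord_ge (int (a ! y) - int (a ! x) + (1 + 2 * int (a ! x))) (t * (2 * ?x))"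
      by (intro hord_ge_mult t two xx(1))
    then show ?thesis using True by (simp add: add_ac)
  next
    case False
    have "hord_ge (int (a ! y) - int (a ! x) + (int (a ! x) + int (a ! k) + 1)) (t * (2 * C $$ (x, k)))"
      using hord_ge_mult[OF t ux[OF k(1) False k(2), unfolded linked_def not_not]] .
    then show ?thesis by (rule hord_ge_mono) simp
  qed
  show False
  proof (rule maximal_for_exact_or_linked[OF sorted D(2) _ y])
    show "maximal_for a D"
      by (rule maximal_for_tri_equiv[OF M_set_carrier[OF C] max D(1)])
    have "hord_ge (2 * int (a ! x) + (2 * int d + 2 * int d) + 1) (?x * (p ^ d * p ^ d) * (s ^ 2 - w))"
      by (intro hord_ge_mult xx(1) pd(1) s(2))
    moreover have "?x * (p ^ d * p ^ d) * (s ^ 2 - w) = ?y + t * t * ?x"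
    proof -
      have "?x * (p ^ d * p ^ d) * w = - ?y" unfolding w_def using nz by simp
      then show ?thesis
        unfolding right_diff_distrib by (simp add: t_def power2_eq_square mult_ac)
    qed
    ultimately have "hord_ge (2 * int (a ! y) + 1) (?y + t * t * ?x)"
      using d by (simp add: add_ac)
    moreover have "hord_ge (2 * int (a ! y) + 1) (t * (2 * C $$ (x, y)))"
      using shift[OF y] by simp
    ultimately have "hord_ge (2 * int (a ! y) + 1) ((?y + t * t * ?x) + t * (2 * C $$ (x, y)))"
      by (rule hord_ge_add)
    then show "\<not> exact a D y"
      unfolding exact_def D(3) by (simp add: add_ac)
    fix j assume j: "j < length a" "j \<noteq> y" "a ! j \<le> a ! y"
    have "hord_ge (int (a ! y) + int (a ! j) + 1) (2 * C $$ (y, j) + t * (2 * C $$ (x, j)))"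
      using uy[OF j] shift[OF j(1,3)] by (intro hord_ge_add) (simp_all add: linked_def)
    then show "\<not> linked a D y j"
      unfolding linked_def D(4)[OF j(1,2)] by (simp add: algebra_simps)
  qed
qed

section \<open>Partial standard involutions\<close>

text \<open>Below \<open>f\<close> these are the lower ends of intervals together with the fixed
  points, the sets P^- and P^0. A fixed point counts as an interval that a later index may still
  close.\<close>

definition opener :: "nat list \<Rightarrow> (nat \<Rightarrow> nat) \<Rightarrow> nat \<Rightarrow> bool" where
  "opener a \<sigma> i \<longleftrightarrow> \<sigma> i = i \<or> a ! i < a ! \<sigma> i"

text \<open>The pairs \<open>(m, \<sigma> m)\<close> with \<open>a ! m < a ! \<sigma> m\<close> of one parity are pairwise non-overlapping
  intervals of values, and a fixed point of that parity lies above all of them.\<close>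

definition standard_upto :: "nat list \<Rightarrow> (nat \<Rightarrow> nat) \<Rightarrow> nat \<Rightarrow> bool" where
  "standard_upto a \<sigma> f \<longleftrightarrow> f \<le> length a \<and> \<sigma> permutes {..<f} \<and> \<sigma> \<circ> \<sigma> = id \<and>
     (\<forall>i<f. opener a \<sigma> i \<longrightarrow> (\<forall>j. i < j \<and> j < length a \<longrightarrow> a ! i < a ! j)) \<and>
     (\<forall>i<f. a ! \<sigma> i < a ! i \<longrightarrow> (\<forall>j<i. a ! j < a ! i)) \<and>
     (\<forall>i<f. a ! i = a ! \<sigma> i \<longrightarrow> \<bar>int (\<sigma> i) - int i\<bar> \<le> 1) \<and>
     (\<forall>i<f. even (a ! i + a ! \<sigma> i)) \<and>
     (\<forall>m<f. \<forall>z<f. opener a \<sigma> m \<and> \<sigma> z = z \<and> even (a ! m + a ! z) \<longrightarrow> a ! m \<le> a ! z) \<and>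
     (\<forall>m<f. \<forall>i<f. a ! m < a ! \<sigma> m \<and> opener a \<sigma> i \<and> even (a ! m + a ! i) \<and> a ! m < a ! i \<longrightarrow>
        a ! \<sigma> m \<le> a ! i)"

lemma standard_uptoD:
  assumes "standard_upto a \<sigma> f"
  shows "f \<le> length a" "\<sigma> permutes {..<f}" "\<sigma> (\<sigma> i) = i" "i < f \<Longrightarrow> \<sigma> i < f" "f \<le> i \<Longrightarrow> \<sigma> i = i"
    and "i < f \<Longrightarrow> opener a \<sigma> i \<Longrightarrow> i < j \<Longrightarrow> j < length a \<Longrightarrow> a ! i < a ! j"
    and "i < f \<Longrightarrow> a ! \<sigma> i < a ! i \<Longrightarrow> j < i \<Longrightarrow> a ! j < a ! i"
    and "i < f \<Longrightarrow> a ! i = a ! \<sigma> i \<Longrightarrow> \<bar>int (\<sigma> i) - int i\<bar> \<le> 1"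
    and "i < f \<Longrightarrow> even (a ! i + a ! \<sigma> i)"
    and "m < f \<Longrightarrow> z < f \<Longrightarrow> opener a \<sigma> m \<Longrightarrow> \<sigma> z = z \<Longrightarrow> even (a ! m + a ! z) \<Longrightarrow> a ! m \<le> a ! z"
    and "m < f \<Longrightarrow> i < f \<Longrightarrow> a ! m < a ! \<sigma> m \<Longrightarrow> opener a \<sigma> i \<Longrightarrow> even (a ! m + a ! i) \<Longrightarrow>
      a ! m < a ! i \<Longrightarrow> a ! \<sigma> m \<le> a ! i"
proof -
  show perm: "\<sigma> permutes {..<f}" using assms by (simp add: standard_upto_def)
  show "\<sigma> (\<sigma> i) = i" using assms unfolding standard_upto_def by (metis comp_apply id_apply)
  show "i < f \<Longrightarrow> \<sigma> i < f" using permutes_in_image[OF perm, of i] by simp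
  show "f \<le> i \<Longrightarrow> \<sigma> i = i" using permutes_not_in[OF perm, of i] by simp
qed (use assms in \<open>unfold standard_upto_def, blast\<close>)+

lemma standard_uptoI:
  assumes "f \<le> length a" "\<sigma> permutes {..<f}" "\<sigma> \<circ> \<sigma> = id"
    and "\<And>i j. i < f \<Longrightarrow> opener a \<sigma> i \<Longrightarrow> i < j \<Longrightarrow> j < length a \<Longrightarrow> a ! i < a ! j"
    and "\<And>i j. i < f \<Longrightarrow> a ! \<sigma> i < a ! i \<Longrightarrow> j < i \<Longrightarrow> a ! j < a ! i"
    and "\<And>i. i < f \<Longrightarrow> a ! i = a ! \<sigma> i \<Longrightarrow> \<bar>int (\<sigma> i) - int i\<bar> \<le> 1"
    and "\<And>i. i < f \<Longrightarrow> even (a ! i + a ! \<sigma> i)"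
    and "\<And>m z. m < f \<Longrightarrow> z < f \<Longrightarrow> opener a \<sigma> m \<Longrightarrow> \<sigma> z = z \<Longrightarrow> even (a ! m + a ! z) \<Longrightarrow> a ! m \<le> a ! z"
    and "\<And>m i. m < f \<Longrightarrow> i < f \<Longrightarrow> a ! m < a ! \<sigma> m \<Longrightarrow> opener a \<sigma> i \<Longrightarrow> even (a ! m + a ! i) \<Longrightarrow>
      a ! m < a ! i \<Longrightarrow> a ! \<sigma> m \<le> a ! i"
  shows "standard_upto a \<sigma> f"
  unfolding standard_upto_def by (intro conjI allI impI; (elim conjE)?; rule assms; assumption)

text \<open>An opener is the last index of its block, so a block contains at most one.\<close>

lemma standard_upto_opener_inj:
  assumes "standard_upto a \<sigma> f" "i < f" "j < f" "opener a \<sigma> i" "opener a \<sigma> j" "a ! i = a ! j"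
  shows "i = j"
proof (rule ccontr)
  assume "i \<noteq> j"
  then consider "i < j" | "j < i" by linarith
  then show False
    using standard_uptoD(1)[OF assms(1)] standard_uptoD(6)[OF assms(1), of i j]
      standard_uptoD(6)[OF assms(1), of j i] assms(2-) by cases auto
qed

text \<open>A fixed point dominates all openers of its parity. Two of them dominate each other and
  hence share a block.\<close>

lemma standard_upto_fixed_unique:
  assumes "standard_upto a \<sigma> f" "i < f" "j < f" "\<sigma> i = i" "\<sigma> j = j" "even (a ! i + a ! j)"
  shows "i = j"
proof (rule standard_upto_opener_inj[OF assms(1-3)])
  show "opener a \<sigma> i" "opener a \<sigma> j" using assms(4,5) by (simp_all add: opener_def)
  then show "a ! i = a ! j"
    using standard_uptoD(10)[OF assms(1), of i j] standard_uptoD(10)[OF assms(1), of j i] assms(2-)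
    by (simp add: add.commute)
qed

lemma card_le_one_if_subset_singleton: "A \<subseteq> {x} \<Longrightarrow> card A \<le> 1"
  using card_mono[of "{x}" A] by simp

text \<open>Since intervals of one parity do not overlap, the nearest upper end above a lower end is
  its own partner, and dually. The cardinality bounds hold because openers sit at the end and upper
  ends at the front of their blocks.\<close>

lemma standard_upto_length_imp_standard_admissible:
  assumes sorted: "sorted a" and std: "standard_upto a \<sigma> (length a)"
  shows "standard_admissible a \<sigma>"
proof -
  note D = standard_uptoD[OF std]
  let ?n = "length a"
  have zero: "i \<in> P_zero a \<sigma> \<longleftrightarrow> i < ?n \<and> \<sigma> i = i" for i by (simp add: P_zero_def)
  have plus: "i \<in> P_plus a \<sigma> \<longleftrightarrow> i < ?n \<and> a ! \<sigma> i < a ! i" for i by (simp add: P_plus_def)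
  have minus: "i \<in> P_minus a \<sigma> \<longleftrightarrow> i < ?n \<and> a ! i < a ! \<sigma> i" for i by (simp add: P_minus_def)
  have opener: "opener a \<sigma> i" if "i \<in> P_minus a \<sigma> \<union> P_zero a \<sigma>" for i
    using that by (auto simp: zero minus opener_def)
  have swap: "\<sigma> i \<in> P_minus a \<sigma> \<longleftrightarrow> i \<in> P_plus a \<sigma>" "\<sigma> i \<in> P_plus a \<sigma> \<longleftrightarrow> i \<in> P_minus a \<sigma>" if "i < ?n" for i
    using that D(3,4) by (auto simp: plus minus)
  have fin: "finite (P_zero a \<sigma>)" "finite (P_plus a \<sigma>)" "finite (P_minus a \<sigma>)"
    by (auto simp: P_zero_def P_plus_def P_minus_def)
  have zero_inj: "a ! i mod 2 \<noteq> a ! j mod 2" if "i \<in> P_zero a \<sigma>" "j \<in> P_zero a \<sigma>" "i \<noteq> j" for i j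
  proof
    assume "a ! i mod 2 = a ! j mod 2"
    then have "even (a ! i + a ! j)" by presburger
    then show False using standard_upto_fixed_unique[OF std, of i j] that by (simp add: zero)
  qed
  then have "inj_on (\<lambda>i. a ! i mod 2) (P_zero a \<sigma>)" by (meson inj_onI)
  moreover have "(\<lambda>i. a ! i mod 2) ` P_zero a \<sigma> \<subseteq> {0, 1}" by auto
  ultimately have "card (P_zero a \<sigma>) \<le> card {0::nat, 1}" by (rule card_inj_on_le) simp
  then have card_zero: "card (P_zero a \<sigma>) \<le> 2" by simp
  have even_iff: "even (x + y) \<longleftrightarrow> x mod 2 = y mod 2" for x y :: nat by presburger
  have parity: "a ! \<sigma> i mod 2 = a ! i mod 2" if "i < ?n" for i
    using D(9)[OF that] unfolding even_iff by (rule sym)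
  have non_overlap: "a ! \<sigma> m \<le> a ! i"
    if "m \<in> P_minus a \<sigma>" "i \<in> P_minus a \<sigma> \<union> P_zero a \<sigma>" "a ! m mod 2 = a ! i mod 2" "a ! m < a ! i" for m i
    using D(11)[OF _ _ _ opener[OF that(2)], of m] that unfolding even_iff minus zero Un_iff by blast
  have same: "m = i"
    if "m \<in> P_minus a \<sigma> \<union> P_zero a \<sigma>" "i \<in> P_minus a \<sigma> \<union> P_zero a \<sigma>" "a ! m = a ! i" for m i
    using standard_upto_opener_inj[OF std, of m i] opener that by (auto simp: minus zero)
  have max_zero: "is_max_of (a ! z) {a ! j | j. j \<in> P_zero a \<sigma> \<union> P_plus a \<sigma> \<and> a ! j mod 2 = a ! z mod 2}"
    if z: "z \<in> P_zero a \<sigma>" for z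
  proof -
    have "a ! j \<le> a ! z" if j: "j \<in> P_zero a \<sigma> \<union> P_plus a \<sigma>" "a ! j mod 2 = a ! z mod 2" for j
    proof (cases "j \<in> P_zero a \<sigma>")
      case True
      then show ?thesis using zero_inj[of j z] z j by blast
    next
      case False
      then have "j \<in> P_plus a \<sigma>" "j < ?n" using j by (auto simp: plus)
      then have m: "\<sigma> j \<in> P_minus a \<sigma>" using swap by blast
      have par: "a ! \<sigma> j mod 2 = a ! z mod 2" using parity \<open>j < ?n\<close> j by simp
      have "a ! \<sigma> j \<le> a ! z"
        using D(10)[OF _ _ opener[OF UnI1[OF m]], of z] m z par unfolding even_iff minus zero by blast
      moreover have "a ! \<sigma> j \<noteq> a ! z"
        using same[of "\<sigma> j" z] m z by (auto simp: zero minus)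
      ultimately have "a ! \<sigma> (\<sigma> j) \<le> a ! z" using non_overlap[OF m _ par] z by auto
      then show ?thesis by (simp add: D(3))
    qed
    then show ?thesis using z unfolding is_max_of_def by blast
  qed
  have min_minus: "is_min_of (a ! \<sigma> i) {a ! j | j. j \<in> P_plus a \<sigma> \<and> a ! j > a ! i \<and> a ! j mod 2 = a ! i mod 2}"
    if i: "i \<in> P_minus a \<sigma>" for i
  proof -
    have "a ! \<sigma> i \<le> a ! j" if j: "j \<in> P_plus a \<sigma>" "a ! j > a ! i" "a ! j mod 2 = a ! i mod 2" for j
    proof -
      have jn: "j < ?n" using j(1) by (simp add: plus)
      have m: "\<sigma> j \<in> P_minus a \<sigma>" using swap jn j by blast
      have par: "a ! \<sigma> j mod 2 = a ! i mod 2" using parity jn j by simp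
      \<comment> \<open>An interval that starts below \<open>i\<close> closes at or below
        \<open>a ! i\<close>, one that starts at \<open>a ! i\<close> is that of \<open>i\<close>,
        and one that starts above does so only after the interval of \<open>i\<close> has
        closed.\<close>
      consider "a ! \<sigma> j < a ! i" | "a ! \<sigma> j = a ! i" | "a ! \<sigma> j > a ! i" by linarith
      then show ?thesis
      proof cases
        case 1
        then have "a ! \<sigma> (\<sigma> j) \<le> a ! i" using non_overlap[OF m _ par] i by blast
        then show ?thesis using j by (simp add: D(3))
      next
        case 2
        then have "\<sigma> j = i" using same m i by blast
        then show ?thesis using D(3) by (metis le_refl)
      next
        case 3
        then have "a ! \<sigma> i \<le> a ! \<sigma> j" using non_overlap[OF i] m par by simp
        then show ?thesis using j by (simp add: plus)
      qed
    qed
    moreover have "\<sigma> i \<in> P_plus a \<sigma> \<and> a ! \<sigma> i > a ! i \<and> a ! \<sigma> i mod 2 = a ! i mod 2"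
      using i swap(2)[of i] parity[of i] by (auto simp: minus)
    ultimately show ?thesis unfolding is_min_of_def by blast
  qed
  have max_plus: "is_max_of (a ! \<sigma> i) {a ! j | j. j \<in> P_minus a \<sigma> \<and> a ! j < a ! i \<and> a ! j mod 2 = a ! i mod 2}"
    if i: "i \<in> P_plus a \<sigma>" for i
  proof -
    have im: "i < ?n" using i by (simp add: plus)
    have m: "\<sigma> i \<in> P_minus a \<sigma>" using i im swap by blast
    have "a ! j \<le> a ! \<sigma> i" if j: "j \<in> P_minus a \<sigma>" "a ! j < a ! i" "a ! j mod 2 = a ! i mod 2" for j
    proof (rule ccontr)
      assume "\<not> a ! j \<le> a ! \<sigma> i"
      then have "a ! \<sigma> (\<sigma> i) \<le> a ! j" using non_overlap[OF m] j parity[OF im] by simp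
      then show False using j by (simp add: D(3))
    qed
    moreover have "\<sigma> i \<in> P_minus a \<sigma> \<and> a ! \<sigma> i < a ! i \<and> a ! \<sigma> i mod 2 = a ! i mod 2"
      using i m parity[OF im] by (simp add: plus)
    ultimately show ?thesis unfolding is_max_of_def by blast
  qed
  have fin_block: "finite (block a c)" for c by (simp add: block_def)
  have max_block: "i = Max (block a c)" if "i \<in> (P_zero a \<sigma> \<union> P_minus a \<sigma>) \<inter> block a c" for i c
  proof (rule Max_eqI[symmetric])
    fix j assume "j \<in> block a c"
    then have j: "j < ?n" "a ! j = a ! i" using that by (simp_all add: block_def)
    have i: "i < ?n" "opener a \<sigma> i" using opener that by (auto simp: block_def)
    show "j \<le> i"
    proof (rule ccontr)
      assume "\<not> j \<le> i"
      then show False using D(6)[OF i _ j(1)] j(2) by simp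
    qed
  qed (use that fin_block in auto)
  have min_block: "i = Min (block a c)" if "i \<in> P_plus a \<sigma> \<inter> block a c" for i c
  proof (rule Min_eqI[symmetric])
    fix j assume "j \<in> block a c"
    then have j: "a ! j = a ! i" using that by (simp add: block_def)
    have i: "i < ?n" "a ! \<sigma> i < a ! i" using that by (simp_all add: plus)
    show "i \<le> j"
    proof (rule ccontr)
      assume "\<not> i \<le> j"
      then show False using D(7)[OF i, of j] j by simp
    qed
  qed (use that fin_block in auto)
  have card_plus: "card (P_plus a \<sigma> \<inter> block a c) \<le> 1" for c
    using min_block by (intro card_le_one_if_subset_singleton[of _ "Min (block a c)"]) blast
  have card_minus_zero: "card (P_minus a \<sigma> \<inter> block a c) + card (P_zero a \<sigma> \<inter> block a c) \<le> 1" for c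
  proof -
    have "card (P_minus a \<sigma> \<inter> block a c) + card (P_zero a \<sigma> \<inter> block a c) =
        card ((P_minus a \<sigma> \<inter> block a c) \<union> (P_zero a \<sigma> \<inter> block a c))"
      using fin by (intro card_Un_disjoint[symmetric]) (auto simp: P_minus_def P_zero_def)
    also have "\<dots> \<le> 1"
      using max_block by (intro card_le_one_if_subset_singleton[of _ "Max (block a c)"]) blast
    finally show ?thesis .
  qed
  have inv: "\<sigma> \<circ> \<sigma> = id" using std by (simp add: standard_upto_def)
  have adm: "admissible a \<sigma>"
    unfolding admissible_def
    by (intro conjI ballI impI;
        (rule D(2) inv card_zero card_plus card_minus_zero | (rule zero_inj max_zero min_minus max_plus; assumption+)))
  show ?thesis
    unfolding standard_admissible_def
    by (intro conjI ballI allI impI;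
        (rule sorted adm | (rule max_block min_block D(8); assumption+)))
qed

text \<open>Sortedness makes the new fixed point dominate all earlier openers. An earlier fixed
  point of its parity would have to dominate it in turn, which \<open>unique\<close> rules
  out.\<close>

lemma standard_upto_fixed:
  assumes sorted: "sorted a" and std: "standard_upto a \<sigma> f" and f: "f < length a"
    and last: "\<And>j. f < j \<Longrightarrow> j < length a \<Longrightarrow> a ! f < a ! j"
    and unique: "\<And>z. z < f \<Longrightarrow> \<sigma> z = z \<Longrightarrow> odd (a ! z + a ! f)"
  shows "standard_upto a \<sigma> (Suc f)"
proof -
  note D = standard_uptoD[OF std]
  have ff: "\<sigma> f = f" using D(5) by simp
  have mono: "a ! i \<le> a ! f" if "i < f" for i using sorted_nth_mono[OF sorted] that f by simp
  have "Suc f \<le> length a" using f by simp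
  moreover have "\<sigma> permutes {..<Suc f}" using D(2) by (rule permutes_subset) auto
  moreover have "\<sigma> \<circ> \<sigma> = id" using std by (simp add: standard_upto_def)
 moreover have "a ! i < a ! j" if "i < Suc f" "opener a \<sigma> i" "i < j" "j < length a" for i j
    using that last[of j] D(6)[of i j] by (cases "i = f") auto
  moreover have "a ! j < a ! i" if "i < Suc f" "a ! \<sigma> i < a ! i" "j < i" for i j
    using that ff D(7)[of i j] by (cases "i = f") auto
  moreover have "\<bar>int (\<sigma> i) - int i\<bar> \<le> 1" if "i < Suc f" "a ! i = a ! \<sigma> i" for i
    using that ff D(8)[of i] by (cases "i = f") auto
  moreover have "even (a ! i + a ! \<sigma> i)" if "i < Suc f" for i
    using that ff D(9)[of i] by (cases "i = f") auto
  moreover have "a ! m \<le> a ! z"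
    if "m < Suc f" "z < Suc f" "opener a \<sigma> m" "\<sigma> z = z" "even (a ! m + a ! z)" for m z
  proof (cases "z = f")
    case True
    then show ?thesis using mono[of m] that by (cases "m = f") auto
  next
    case False
    then have "z < f" using that by simp
    moreover have "m \<noteq> f" using unique[OF \<open>z < f\<close> that(4)] that(5) by (auto simp: add.commute)
    ultimately show ?thesis using D(10)[of m z] that by simp
  qed
  moreover have "a ! \<sigma> m \<le> a ! i"
    if "m < Suc f" "i < Suc f" "a ! m < a ! \<sigma> m" "opener a \<sigma> i" "even (a ! m + a ! i)" "a ! m < a ! i" for m i
  proof -
    have "m < f" using that ff by (cases "m = f") auto
    then show ?thesis
      using D(11)[of m i] that mono[of "\<sigma> m"] D(4)[of m] by (cases "i = f") auto
  qed
  ultimately show ?thesis by (rule standard_uptoI)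
qed

lemma permutes_pair:
  assumes perm: "\<sigma> permutes S" and fixed: "\<sigma> p = p" "\<sigma> q = q" and inv: "\<sigma> \<circ> \<sigma> = id"
  shows "\<sigma>(p := q, q := p) permutes (S \<union> {p, q})" "\<sigma>(p := q, q := p) \<circ> \<sigma>(p := q, q := p) = id"
proof -
  have \<sigma>\<sigma>: "\<sigma> (\<sigma> x) = x" for x using inv by (metis comp_apply id_apply)
  show eq: "\<sigma>(p := q, q := p) \<circ> \<sigma>(p := q, q := p) = id"
  proof
    fix x
    have "\<sigma> x = p \<longleftrightarrow> x = p" "\<sigma> x = q \<longleftrightarrow> x = q" using \<sigma>\<sigma> fixed by metis+
    then show "(\<sigma>(p := q, q := p) \<circ> \<sigma>(p := q, q := p)) x = id x" using \<sigma>\<sigma> by auto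
  qed
  have "bij (\<sigma>(p := q, q := p))" using eq by (rule o_bij[OF eq])
  then show "\<sigma>(p := q, q := p) permutes (S \<union> {p, q})"
    using permutes_not_in[OF perm] by (auto simp: permutes_def bij_iff)
qed

text \<open>Partners of equal value are neither openers nor upper ends, so every interval condition
  is inherited and only adjacency is new.\<close>

lemma standard_upto_pair_same:
  assumes sorted: "sorted a" and std: "standard_upto a \<sigma> f" and f: "Suc f < length a"
    and eq: "a ! f = a ! Suc f"
  shows "standard_upto a (\<sigma>(f := Suc f, Suc f := f)) (Suc (Suc f))"
proof -
  note D = standard_uptoD[OF std]
  let ?\<tau> = "\<sigma>(f := Suc f, Suc f := f)"
  have \<tau>: "?\<tau> i = \<sigma> i" if "i < f" for i using that by simp
  have fixed: "\<sigma> f = f" "\<sigma> (Suc f) = Suc f" using D(5) by simp_all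
  have inv: "\<sigma> \<circ> \<sigma> = id" using std by (simp add: standard_upto_def)
  have op: "i < f" "opener a \<sigma> i" if "i < Suc (Suc f)" "opener a ?\<tau> i" for i
    using that eq by (auto simp: opener_def less_Suc_eq split: if_splits)
  have less: "i < f" if "i < Suc (Suc f)" "a ! i \<noteq> a ! ?\<tau> i" for i
    using that eq by (auto simp: less_Suc_eq split: if_splits)
  have "Suc (Suc f) \<le> length a" using f by simp
  moreover have "?\<tau> permutes {..<Suc (Suc f)}"
    using permutes_pair(1)[OF D(2) fixed inv] by (rule permutes_subset) auto
  moreover have "?\<tau> \<circ> ?\<tau> = id" by (rule permutes_pair(2)[OF D(2) fixed inv])
  moreover have "a ! i < a ! j" if "i < Suc (Suc f)" "opener a ?\<tau> i" "i < j" "j < length a" for i j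
    using D(6)[OF op[OF that(1,2)] that(3,4)] .
  moreover have "a ! j < a ! i" if "i < Suc (Suc f)" "a ! ?\<tau> i < a ! i" "j < i" for i j
    using less[of i] \<tau>[of i] D(7)[of i j] that by simp
  moreover have "\<bar>int (?\<tau> i) - int i\<bar> \<le> 1" if "i < Suc (Suc f)" "a ! i = a ! ?\<tau> i" for i
    using D(8)[of i] that by (auto simp: less_Suc_eq split: if_splits)
  moreover have "even (a ! i + a ! ?\<tau> i)" if "i < Suc (Suc f)" for i
    using D(9)[of i] that eq by (auto simp: less_Suc_eq split: if_splits)
  moreover have "a ! m \<le> a ! z"
    if "m < Suc (Suc f)" "z < Suc (Suc f)" "opener a ?\<tau> m" "?\<tau> z = z" "even (a ! m + a ! z)" for m z
    using op[OF that(1,3)] op(1)[OF that(2)] D(10)[of m z] that by (simp add: opener_def)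
  moreover have "a ! ?\<tau> m \<le> a ! i"
    if "m < Suc (Suc f)" "i < Suc (Suc f)" "a ! m < a ! ?\<tau> m" "opener a ?\<tau> i" "even (a ! m + a ! i)"
      "a ! m < a ! i" for m i
    using op[OF that(2,4)] less[OF that(1)] D(11)[of m i] that by simp
  ultimately show ?thesis by (rule standard_uptoI)
qed

text \<open>As a fixed point, \<open>z\<close> lies above all openers of its parity, so no lower end
  can fall inside the interval that is now closed.\<close>

lemma standard_upto_pair_less:
  assumes sorted: "sorted a" and std: "standard_upto a \<sigma> f" and f: "f < length a"
    and z: "z < f" "\<sigma> z = z" "even (a ! z + a ! f)" and first: "\<And>j. j < f \<Longrightarrow> a ! j < a ! f"
  shows "standard_upto a (\<sigma>(z := f, f := z)) (Suc f)"
proof -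
  note D = standard_uptoD[OF std]
  let ?\<tau> = "\<sigma>(z := f, f := z)"
  have \<tau>: "?\<tau> i = \<sigma> i" if "i < f" "i \<noteq> z" for i using that by simp
  have zf: "z \<noteq> f" "a ! z < a ! f" using z first by auto
  have fixed: "\<sigma> f = f" using D(5) by simp
  have inv: "\<sigma> \<circ> \<sigma> = id" using std by (simp add: standard_upto_def)
  have op: "i < f" "opener a \<sigma> i" if "i < Suc f" "opener a ?\<tau> i" for i
    using that zf z by (auto simp: opener_def less_Suc_eq split: if_splits)
  have fp: "i < f \<and> i \<noteq> z \<and> \<sigma> i = i" if "i < Suc f" "?\<tau> i = i" for i
    using that zf by (auto simp: less_Suc_eq split: if_splits)
  have "Suc f \<le> length a" using f by simp
  moreover have "?\<tau> permutes {..<Suc f}"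
    using permutes_pair(1)[OF D(2) z(2) fixed inv] by (rule permutes_subset) (use z in auto)
  moreover have "?\<tau> \<circ> ?\<tau> = id" by (rule permutes_pair(2)[OF D(2) z(2) fixed inv])
  moreover have "a ! i < a ! j" if "i < Suc f" "opener a ?\<tau> i" "i < j" "j < length a" for i j
    using D(6)[OF op[OF that(1,2)] that(3,4)] .
  moreover have "a ! j < a ! i" if "i < Suc f" "a ! ?\<tau> i < a ! i" "j < i" for i j
  proof (cases "i = f")
    case True
    then show ?thesis using first that by simp
  next
    case False
    then have "i < f" "i \<noteq> z" using that zf by auto
    then show ?thesis using D(7)[of i j] that by simp
  qed
  moreover have "\<bar>int (?\<tau> i) - int i\<bar> \<le> 1" if "i < Suc f" "a ! i = a ! ?\<tau> i" for i
    using D(8)[of i] that zf by (auto simp: less_Suc_eq split: if_splits)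
  moreover have "even (a ! i + a ! ?\<tau> i)" if "i < Suc f" for i
    using D(9)[of i] that z(3) by (auto simp: less_Suc_eq split: if_splits)
  moreover have "a ! m \<le> a ! y"
    if "m < Suc f" "y < Suc f" "opener a ?\<tau> m" "?\<tau> y = y" "even (a ! m + a ! y)" for m y
    using op[OF that(1,3)] fp[OF that(2,4)] D(10)[of m y] that by simp
  moreover have "a ! ?\<tau> m \<le> a ! i"
    if "m < Suc f" "i < Suc f" "a ! m < a ! ?\<tau> m" "opener a ?\<tau> i" "even (a ! m + a ! i)" "a ! m < a ! i" for m i
  proof (cases "m = z")
    case True
    then have "a ! i \<le> a ! z"
      using D(10)[of i z] op[OF that(2,4)] z that(5) by (simp add: add.commute)
    then show ?thesis using True that(6) by simp
  next
    case False
    moreover have "m \<noteq> f" using that(3) zf by auto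
    ultimately show ?thesis using D(11)[of m i] op[OF that(2,4)] that by simp
  qed
  ultimately show ?thesis by (rule standard_uptoI)
qed

section \<open>Reduction of one more index\<close>

text \<open>The fifth clause says that pairs are split off completely, while a fixed point may still
  be linked to unprocessed indices. The last clause concerns a scan standing inside a block: no
  fixed point is linked to the rest of that block. Hence a fixed point can only find a partner at
  the start of a block, as a standard involution demands.\<close>

definition reduced_upto :: "nat list \<Rightarrow> 'a::discretely_valued_field mat \<Rightarrow> (nat \<Rightarrow> nat) \<Rightarrow> nat \<Rightarrow> bool" where
  "reduced_upto a C \<sigma> f \<longleftrightarrow> C \<in> M_set a \<and> standard_upto a \<sigma> f \<and>
     (\<forall>i<f. \<sigma> i \<noteq> i \<longrightarrow> linked a C i (\<sigma> i)) \<and>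
     (\<forall>i<f. opener a \<sigma> i \<longrightarrow> exact a C i) \<and>
     (\<forall>i<f. \<forall>j<length a. j \<noteq> i \<and> j \<noteq> \<sigma> i \<and> linked a C i j \<longrightarrow> \<sigma> i = i \<and> f \<le> j) \<and>
     (\<forall>i<f. \<sigma> i = i \<longrightarrow> (\<forall>j. f \<le> j \<and> j < length a \<and> a ! j = a ! (f - 1) \<longrightarrow> \<not> linked a C i j))"

lemma reduced_uptoD:
  assumes "reduced_upto a C \<sigma> f"
  shows "C \<in> M_set a" "standard_upto a \<sigma> f"
    "i < f \<Longrightarrow> \<sigma> i \<noteq> i \<Longrightarrow> linked a C i (\<sigma> i)"
    "i < f \<Longrightarrow> opener a \<sigma> i \<Longrightarrow> exact a C i"
    "i < f \<Longrightarrow> j < length a \<Longrightarrow> j \<noteq> i \<Longrightarrow> j \<noteq> \<sigma> i \<Longrightarrow> linked a C i j \<Longrightarrow> \<sigma> i = i \<and> f \<le> j"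
    "i < f \<Longrightarrow> \<sigma> i = i \<Longrightarrow> f \<le> j \<Longrightarrow> j < length a \<Longrightarrow> a ! j = a ! (f - 1) \<Longrightarrow> \<not> linked a C i j"
  using assms unfolding reduced_upto_def by blast+

lemma reduced_uptoI:
  assumes "C \<in> M_set a" "standard_upto a \<sigma> f"
    and "\<And>i. i < f \<Longrightarrow> \<sigma> i \<noteq> i \<Longrightarrow> linked a C i (\<sigma> i)"
    and "\<And>i. i < f \<Longrightarrow> opener a \<sigma> i \<Longrightarrow> exact a C i"
    and "\<And>i j. i < f \<Longrightarrow> j < length a \<Longrightarrow> j \<noteq> i \<Longrightarrow> j \<noteq> \<sigma> i \<Longrightarrow> linked a C i j \<Longrightarrow> \<sigma> i = i \<and> f \<le> j"
    and "\<And>i j. i < f \<Longrightarrow> \<sigma> i = i \<Longrightarrow> f \<le> j \<Longrightarrow> j < length a \<Longrightarrow> a ! j = a ! (f - 1) \<Longrightarrow> \<not> linked a C i j"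
  shows "reduced_upto a C \<sigma> f"
proof -
  have "\<forall>i<f. \<sigma> i \<noteq> i \<longrightarrow> linked a C i (\<sigma> i)"
    by (intro allI impI) (rule assms(3))
  moreover have "\<forall>i<f. opener a \<sigma> i \<longrightarrow> exact a C i"
    by (intro allI impI) (rule assms(4))
  moreover have "\<forall>i<f. \<forall>j<length a. j \<noteq> i \<and> j \<noteq> \<sigma> i \<and> linked a C i j \<longrightarrow> \<sigma> i = i \<and> f \<le> j"
    by (intro allI impI, elim conjE) (rule assms(5))
  moreover have "\<forall>i<f. \<sigma> i = i \<longrightarrow>
      (\<forall>j. f \<le> j \<and> j < length a \<and> a ! j = a ! (f - 1) \<longrightarrow> \<not> linked a C i j)"
    by (intro allI impI, elim conjE) (rule assms(6))
  ultimately show ?thesis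
    unfolding reduced_upto_def using assms(1,2) by (intro conjI)
qed

lemma reduced_upto_swap:
  assumes C: "reduced_upto a C \<sigma> f" and p: "f \<le> p" "p < length a" and q: "f \<le> q" "q < length a"
    and eq: "a ! p = a ! q"
  obtains D where "tri_equiv a C D" "reduced_upto a D \<sigma> f"
    "\<And>i j. i < length a \<Longrightarrow> j < length a \<Longrightarrow>
       linked a D i j \<longleftrightarrow> linked a C (transpose p q i) (transpose p q j)"
proof -
  note R = reduced_uptoD[OF C]
  note S = standard_uptoD[OF R(2)]
  obtain D where D: "tri_equiv a C D" "D \<in> M_set a"
    "\<And>k l. k < length a \<Longrightarrow> l < length a \<Longrightarrow> D $$ (k, l) = C $$ (transpose p q k, transpose p q l)"
    using tri_equiv_swap[OF R(1) p(2) q(2) eq] by metis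
  have tr: "a ! transpose p q k = a ! k" "k < length a \<Longrightarrow> transpose p q k < length a"
    "k < f \<Longrightarrow> transpose p q k = k" "f \<le> transpose p q k \<longleftrightarrow> f \<le> k" for k
    using eq p q by (auto simp: transpose_def)
  have linked_D: "linked a D i j \<longleftrightarrow> linked a C (transpose p q i) (transpose p q j)"
    if "i < length a" "j < length a" for i j
    using that by (simp add: linked_def D(3) tr(1))
  have len: "i < length a" if "i < f" for i using that S(1) by simp
  have "linked a D i (\<sigma> i)" if "i < f" "\<sigma> i \<noteq> i" for i
    using R(3)[OF that] that S(4)[OF that(1)] by (simp add: linked_D len tr(3))
  moreover have "exact a D i" if "i < f" "opener a \<sigma> i" for i
    using R(4)[OF that] that by (simp add: exact_def D(3) len tr(3))
  moreover have "\<sigma> i = i \<and> f \<le> j" if "i < f" "j < length a" "j \<noteq> i" "j \<noteq> \<sigma> i" "linked a D i j" for i j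
  proof -
    have "transpose p q j \<noteq> i" "transpose p q j \<noteq> \<sigma> i"
      using that tr(3)[of i] tr(3)[of "\<sigma> i"] S(4) by (metis transpose_involutory)+
    then show ?thesis
      using R(5)[OF that(1), of "transpose p q j"] that by (simp add: linked_D len tr)
  qed
  moreover have "\<not> linked a D i j"
    if "i < f" "\<sigma> i = i" "f \<le> j" "j < length a" "a ! j = a ! (f - 1)" for i j
    using R(6)[OF that(1,2), of "transpose p q j"] that by (simp add: linked_D len tr)
  ultimately have "reduced_upto a D \<sigma> f"
    by (rule reduced_uptoI[OF D(2) R(2)])
  with D(1) linked_D that show thesis by blast
qed

text \<open>Here \<open>p\<close> is either an earlier fixed point of \<open>\<sigma>\<close> or, like \<open>q\<close>, a new index.\<close>

lemma reduced_upto_match: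
  fixes C :: "'a::discretely_valued_field mat"
  assumes two: "hord_ge 1 (2::'a)" and sorted: "sorted a" and C: "reduced_upto a C \<sigma> f"
    and f': "f' \<le> length a" "\<And>i. i < f' \<longleftrightarrow> i < f \<or> i = p \<or> i = q" "a ! (f' - 1) = a ! q"
    and q: "f \<le> q" and fixed: "\<sigma> p = p" and p: "p < f \<Longrightarrow> exact a C p" and p': "f \<le> p \<Longrightarrow> a ! p = a ! q"
    and ne: "p \<noteq> q" and pq: "linked a C p q"
    and std: "standard_upto a (\<sigma>(p := q, q := p)) f'"
    and unlinked: "\<And>i j. i < f \<Longrightarrow> \<sigma> i = i \<Longrightarrow> i \<noteq> p \<Longrightarrow> f \<le> j \<Longrightarrow> j < length a \<Longrightarrow> a ! j = a ! q \<Longrightarrow>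
      \<not> linked a C i j"
  obtains D where "tri_equiv a C D" "reduced_upto a D (\<sigma>(p := q, q := p)) f'"
proof -
  note R = reduced_uptoD[OF C]
  note S = standard_uptoD[OF R(2)]
  let ?\<tau> = "\<sigma>(p := q, q := p)"
  \<comment> \<open>Clearing the unprocessed indices is enough, because the processed ones turn out
    to be unlinked from \<open>p\<close> and \<open>q\<close>.\<close>
  let ?K = "{f'..<length a}"
  have pf: "p < f'" "q < f'" by (simp_all add: f'(2))
  have ff': "f \<le> f'" using f'(2)[of f'] by simp
  have old: "i < f" if "i < f'" "i \<noteq> p" "i \<noteq> q" for i using that by (simp add: f'(2))
  have pn: "p < length a" "q < length a" using pf f'(1) by simp_all
  have K: "\<forall>k\<in>?K. k < length a \<and> k \<noteq> p \<and> k \<noteq> q \<and> a ! p \<le> a ! k \<and> a ! q \<le> a ! k"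
  proof
    fix k assume "k \<in> ?K"
    then have k: "p < k" "q < k" "k < length a" using pf by simp_all
    then show "k < length a \<and> k \<noteq> p \<and> k \<noteq> q \<and> a ! p \<le> a ! k \<and> a ! q \<le> a ! k"
      using sorted_nth_mono[OF sorted, of p k] sorted_nth_mono[OF sorted, of q k] by simp
  qed
  obtain D where D: "tri_equiv a C D" "D \<in> M_set a"
    "\<forall>k\<in>?K. \<not> linked a D p k \<and> \<not> linked a D q k"
    "\<forall>i j. i < length a \<longrightarrow> j < length a \<longrightarrow> i \<notin> ?K \<longrightarrow> j \<notin> ?K \<longrightarrow> D $$ (i, j) = C $$ (i, j)"
    "\<forall>z k. z < length a \<longrightarrow> z \<noteq> p \<longrightarrow> z \<noteq> q \<longrightarrow> z \<notin> ?K \<longrightarrow> \<not> linked a C p z \<longrightarrow> \<not> linked a C q z \<longrightarrow>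
      k \<in> ?K \<longrightarrow> (linked a D k z \<longleftrightarrow> linked a C k z)"
    using clear_set[OF two R(1) pn ne pq finite_atLeastLessThan K]
    by (elim exE conjE) (rule that)
  have len: "i < length a" if "i < f'" for i using that f'(1) by simp
  have low: "linked a D i j \<longleftrightarrow> linked a C i j" if "i < f'" "j < f'" for i j
    using D(4)[rule_format, OF len[OF that(1)] len[OF that(2)]] that by (intro linked_cong) simp
  have q_fixed: "\<sigma> q = q" using S(5)[OF q] .
  have pq_new: "j \<in> {p, q} \<Longrightarrow> f \<le> j \<Longrightarrow> a ! j = a ! q" for j using p' by auto
  have unlinked_pq: "\<not> linked a C i j" if i: "i < f" "i \<noteq> p" and j: "j \<in> {p, q}" for i j
  proof
    assume "linked a C i j"
    have ji: "j \<noteq> i" using i j q by auto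
    moreover have "j \<noteq> \<sigma> i"
    proof
      assume "j = \<sigma> i"
      then have "\<sigma> j = i" using S(3) by simp
      then show False using j fixed q_fixed ji by auto
    qed
    moreover have jn: "j < length a" using j pn by auto
    ultimately have "\<sigma> i = i" "f \<le> j" using R(5)[OF i(1), of j] \<open>linked a C i j\<close> by simp_all
    then show False using unlinked[OF i(1) _ i(2) _ jn pq_new[OF j]] \<open>linked a C i j\<close> by simp
  qed
  \<comment> \<open>The waiting fixed points keep their links to later indices: being unlinked from
    the pair, they are unaffected when the pair is used for clearing.\<close>
  have high: "linked a D i j \<longleftrightarrow> linked a C i j" if i: "i < f" "i \<noteq> p" and j: "f' \<le> j" "j < length a" for i j
  proof -
    have i': "i < length a" "i \<notin> ?K" "i \<noteq> q" using i q pf S(1) by auto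
    have "\<not> linked a C p i" "\<not> linked a C q i"
      using unlinked_pq[OF i] linked_sym[OF R(1) pn(1) i'(1)] linked_sym[OF R(1) pn(2) i'(1)] by simp_all
    then have "linked a D j i \<longleftrightarrow> linked a C j i"
      using D(5)[rule_format, OF i'(1) i(2) i'(3,2), of j] j by simp
    then show ?thesis using linked_sym[OF R(1) i'(1) j(2)] linked_sym[OF D(2) i'(1) j(2)] by simp
  qed
  have "linked a D i (?\<tau> i)" if i: "i < f'" "?\<tau> i \<noteq> i" for i
  proof -
    have "linked a C i (?\<tau> i)"
    proof (cases "i \<in> {p, q}")
      case True
      then show ?thesis using pq linked_sym[OF R(1) pn] ne by auto
    next
      case False
      then show ?thesis using R(3)[of i] old[OF i(1)] i(2) by auto
    qed
    moreover have "?\<tau> i < f'" using standard_uptoD(4)[OF std i(1)] .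
    ultimately show ?thesis using low[OF i(1)] by blast
  qed
  moreover have "exact a D i" if i: "i < f'" "opener a ?\<tau> i" for i
  proof -
    have "exact a C i"
    proof (cases "i \<in> {p, q}")
      case True
      \<comment> \<open>Exactness is demanded of openers only. The partner of \<open>q\<close> has
        no larger value, and two new indices have equal values, so among the pair only an old fixed
        point \<open>p\<close> can be an opener.\<close>
      have "i = p \<and> p < f"
      proof (rule ccontr)
        assume *: "\<not> (i = p \<and> p < f)"
        have "a ! p \<le> a ! q"
        proof (cases "p < f")
          case True
          then show ?thesis using sorted_nth_mono[OF sorted, of p q] q pn by simp
        next
          case False
          then show ?thesis using p' by simp
        qed
        have "i = q \<or> i = p \<and> f \<le> p" using * True by auto
        then have "a ! ?\<tau> i \<le> a ! i" "?\<tau> i \<noteq> i" using \<open>a ! p \<le> a ! q\<close> p' ne by auto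
        then show False using i(2) unfolding opener_def by linarith
      qed
      then show ?thesis using p by blast
    next
      case False
      then show ?thesis using R(4)[of i] old[OF i(1)] i(2) by (auto simp: opener_def)
    qed
    moreover have "D $$ (i, i) = C $$ (i, i)"
      using D(4)[rule_format, OF len[OF i(1)] len[OF i(1)]] i(1) by simp
    ultimately show ?thesis using exact_cong by blast
  qed
  moreover have "?\<tau> i = i \<and> f' \<le> j"
    if i: "i < f'" and j: "j < length a" "j \<noteq> i" "j \<noteq> ?\<tau> i" and l: "linked a D i j" for i j
  proof (cases "i \<in> {p, q}")
    case True
    then have j': "j \<noteq> p" "j \<noteq> q" using j(2,3) ne by auto
    have "j < f'"
    proof (rule ccontr)
      assume "\<not> j < f'"
      then have "\<not> linked a D p j \<and> \<not> linked a D q j" using D(3) j(1) by simp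
      then show False using True l by auto
    qed
    then have "j < f" using old j' by simp
    moreover have "linked a C j i"
      using l low[OF i \<open>j < f'\<close>] linked_sym[OF R(1) len[OF i] j(1)] by simp
    ultimately show ?thesis using unlinked_pq[OF _ j'(1) True] by simp
  next
    case False
    then have i': "i < f" "i \<noteq> p" "i \<noteq> q" using old[OF i] by auto
    then have \<tau>: "?\<tau> i = \<sigma> i" by simp
    show ?thesis
    proof (cases "j < f'")
      case True
      then have l': "linked a C i j" using l low[OF i] by simp
      then have "j \<noteq> p" "j \<noteq> q" using unlinked_pq[OF i'(1,2), of j] by auto
      then have "j < f" using old True by simp
      then show ?thesis using R(5)[OF i'(1) j(1,2)] j(3) l' \<tau> by simp
    next
      case False
      then show ?thesis using R(5)[OF i'(1) j(1,2)] j l high[OF i'(1,2)] \<tau> by simp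
    qed
  qed
  moreover have "\<not> linked a D i j"
    if i: "i < f'" "?\<tau> i = i" and j: "f' \<le> j" "j < length a" "a ! j = a ! (f' - 1)" for i j
  proof -
    have "i \<noteq> p" "i \<noteq> q" using i(2) ne by (auto split: if_splits)
    then show ?thesis
      using old[OF i(1)] high[of i j] unlinked[of i j] i(2) j ff' f'(3) by simp
  qed
  ultimately have "reduced_upto a D ?\<tau> f'"
    by (rule reduced_uptoI[OF D(2) std])
  with D(1) that show thesis by blast
qed

text \<open>Links from old fixed points take precedence: they must be used up at the start of a
  block, and a pair inside the block may be formed only once they are absent. If there is neither
  kind of link, maximality forces the unprocessed rest of the block to be the single index
  \<open>f\<close>, which becomes a fixed point.\<close>

lemma reduced_upto_step:
  fixes C :: "'a::nonarch_local_field mat"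
  assumes two: "hord_ge 1 (2::'a)" and sorted: "sorted a" and C: "reduced_upto a C \<sigma> f"
    and max: "maximal_for a C" and f: "f < length a"
  obtains D \<tau> f' where "f < f'" "tri_equiv a C D" "reduced_upto a D \<tau> f'"
proof -
  note R = reduced_uptoD[OF C]
  note S = standard_uptoD[OF R(2)]
  have fixed_new: "\<sigma> j = j" if "f \<le> j" for j using S(5) that .
  have parity: "even (a ! i + a ! j)" if "i < f" "f \<le> j" "j < length a" "linked a C i j" for i j
    using linked_parity[OF R(1) _ that(3) _ that(4)] that S(1) by simp
  consider (old) z j where "z < f" "\<sigma> z = z" "f \<le> j" "j < length a" "a ! j = a ! f" "linked a C z j"
    | (new) i j where "f \<le> i" "i < length a" "f \<le> j" "j < length a" "i \<noteq> j" "a ! i = a ! f" "a ! j = a ! f"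
      "linked a C i j"
      "\<And>z j. z < f \<Longrightarrow> \<sigma> z = z \<Longrightarrow> f \<le> j \<Longrightarrow> j < length a \<Longrightarrow> a ! j = a ! f \<Longrightarrow> \<not> linked a C z j"
    | (none) "\<And>z j. z < f \<Longrightarrow> \<sigma> z = z \<Longrightarrow> f \<le> j \<Longrightarrow> j < length a \<Longrightarrow> a ! j = a ! f \<Longrightarrow> \<not> linked a C z j"
      "\<And>i j. f \<le> i \<Longrightarrow> i < length a \<Longrightarrow> f \<le> j \<Longrightarrow> j < length a \<Longrightarrow> i \<noteq> j \<Longrightarrow> a ! i = a ! f \<Longrightarrow>
        a ! j = a ! f \<Longrightarrow> \<not> linked a C i j"
    by metis
  then show thesis
  proof cases
    case old
    \<comment> \<open>The last clause of \<open>reduced_upto\<close> excludes such a link inside a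
      block that was already entered, so \<open>f\<close> starts a new one.\<close>
    have f0: "a ! (f - 1) \<noteq> a ! f" using R(6)[OF old(1-4)] old(5,6) by auto
    have first: "a ! j < a ! f" if "j < f" for j
    proof -
      have "j \<le> f - 1" "f - 1 < length a" "f - 1 \<le> f" using that f by simp_all
      then have "a ! j \<le> a ! (f - 1)" "a ! (f - 1) \<le> a ! f"
        using sorted_nth_mono[OF sorted] f by blast+
      then show ?thesis using f0 by linarith
    qed
    have even: "even (a ! z + a ! f)" using parity[OF old(1,3,4,6)] old(5) by simp
    obtain D where D: "tri_equiv a C D" "reduced_upto a D \<sigma> f"
      "\<And>i k. i < length a \<Longrightarrow> k < length a \<Longrightarrow>
         linked a D i k \<longleftrightarrow> linked a C (transpose f j i) (transpose f j k)"
      using reduced_upto_swap[OF C order_refl f old(3,4) old(5)[symmetric]] by metis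
    note RD = reduced_uptoD[OF D(2)]
    have zf: "z < length a" using old(1) f by simp
    have link: "linked a D z f" using D(3)[OF zf f] old by (simp add: transpose_def)
    \<comment> \<open>A link into the block fixes the parity, and \<open>z\<close> is the only fixed
      point of that parity.\<close>
    have unlinked: "\<not> linked a D i k"
      if i: "i < f" "\<sigma> i = i" "i \<noteq> z" and k: "f \<le> k" "k < length a" "a ! k = a ! f" for i k
    proof
      assume "linked a D i k"
      then have "even (a ! i + a ! k)"
        using linked_parity[OF RD(1) _ k(2)] i k f by simp
      then have "even (a ! i + a ! z)" using even k(3) by simp
      then show False using standard_upto_fixed_unique[OF R(2) i(1) old(1) i(2) old(2)] i(3) by blast
    qed
    have exact: "exact a D z" using RD(4)[OF old(1)] old(2) by (simp add: opener_def)
    have std: "standard_upto a (\<sigma>(z := f, f := z)) (Suc f)"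
      by (rule standard_upto_pair_less[OF sorted R(2) f old(1,2) even first])
    obtain E where "tri_equiv a D E" "reduced_upto a E (\<sigma>(z := f, f := z)) (Suc f)"
      by (rule reduced_upto_match[OF two sorted D(2), of "Suc f" z f])
        (use f old(1,2) link unlinked exact std in auto)
    then show thesis using that[of "Suc f"] tri_equiv_trans[OF M_set_carrier[OF R(1)] D(1)] by blast
  next
    case new
    have len: "Suc f < length a" "a ! f = a ! Suc f"
    proof -
      obtain m where m: "f < m" "m < length a" "a ! m = a ! f"
        using new(1-7) by (metis le_neq_implies_less linorder_neqE_nat order_le_less_trans)
      then show "Suc f < length a" by simp
      then show "a ! f = a ! Suc f"
        using sorted_nth_mono[OF sorted, of f "Suc f"] sorted_nth_mono[OF sorted, of "Suc f" m] m by simp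
    qed
    obtain D where D: "tri_equiv a C D" "reduced_upto a D \<sigma> f"
      "\<And>k l. k < length a \<Longrightarrow> l < length a \<Longrightarrow>
         linked a D k l \<longleftrightarrow> linked a C (transpose f i k) (transpose f i l)"
      using reduced_upto_swap[OF C order_refl f new(1,2) new(6)[symmetric]] by metis
    \<comment> \<open>The position of \<open>j\<close> after \<open>i\<close> has been moved to
      \<open>f\<close>; it is \<open>i\<close> itself when \<open>j = f\<close>.\<close>
    define m where "m = transpose f i j"
    have m: "f < m" "m < length a" "a ! m = a ! f" "transpose f i m = j"
      using new(1-7) f unfolding m_def by (auto simp: transpose_def)
    have fm: "linked a D f m" using D(3)[OF f m(2)] m(4) new(8) by simp
    obtain E where E: "tri_equiv a D E" "reduced_upto a E \<sigma> f"
      "\<And>k l. k < length a \<Longrightarrow> l < length a \<Longrightarrow>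
         linked a E k l \<longleftrightarrow> linked a D (transpose (Suc f) m k) (transpose (Suc f) m l)"
      using reduced_upto_swap[OF D(2) le_SucI[OF order_refl] len(1) less_imp_le[OF m(1)] m(2)] m(3) len(2)
      by metis
    have "transpose (Suc f) m f = f" using m(1) by (simp add: transpose_def)
    then have link: "linked a E f (Suc f)" using E(3)[OF f len(1)] fm by simp
    have unlinked: "\<not> linked a E z k"
      if z: "z < f" "\<sigma> z = z" and k: "f \<le> k" "k < length a" "a ! k = a ! Suc f" for z k
    proof -
      define k1 where "k1 = transpose (Suc f) m k"
      define k2 where "k2 = transpose f i k1"
      have k1: "f \<le> k1" "k1 < length a" "a ! k1 = a ! f"
        using k m(1-3) len by (auto simp: k1_def transpose_def)
      then have k2: "f \<le> k2" "k2 < length a" "a ! k2 = a ! f"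
        using new(1,2,6) f by (auto simp: k2_def transpose_def)
      have "transpose (Suc f) m z = z" "transpose f i z = z"
        using z(1) m(1) new(1) by (auto simp: transpose_def)
      then have "linked a E z k \<longleftrightarrow> linked a C z k2"
        using E(3)[of z k] D(3)[of z k1] z(1) k(2) k1(2) f by (simp add: k1_def k2_def)
      then show ?thesis using new(9)[OF z k2] by simp
    qed
    have std: "standard_upto a (\<sigma>(f := Suc f, Suc f := f)) (Suc (Suc f))"
      by (rule standard_upto_pair_same[OF sorted R(2) len])
    obtain F where F: "tri_equiv a E F" "reduced_upto a F (\<sigma>(f := Suc f, Suc f := f)) (Suc (Suc f))"
      by (rule reduced_upto_match[OF two sorted E(2), of "Suc (Suc f)" f "Suc f"])
        (use len link std unlinked fixed_new in auto)
    have "tri_equiv a C F"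
      using tri_equiv_trans[OF M_set_carrier[OF R(1)]] D(1) E(1) F(1) by blast
    then show thesis using that[of "Suc (Suc f)"] F(2) by simp
  next
    case none
    \<comment> \<open>Every remaining vector of the block is orthogonal, in the residue form, to all
      vectors up to this block, so both consequences of maximality apply to it.\<close>
    have unlinked: "\<not> linked a C y j"
      if y: "f \<le> y" "y < length a" "a ! y = a ! f" and j: "j < length a" "j \<noteq> y" "a ! j \<le> a ! y" for y j
    proof (cases "j < f")
      case True
      have "\<not> linked a C j y"
      proof
        assume l: "linked a C j y"
        have "y \<noteq> j" "y \<noteq> \<sigma> j" using S(4)[OF True] True y(1) by auto
        then have "\<sigma> j = j" using R(5)[OF True y(2) _ _ l] by blast
        then show False using none(1)[OF True _ y] l by blast
      qed
      then show ?thesis using linked_sym[OF R(1) y(2) j(1)] by blast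
    next
      case False
      then have "a ! j = a ! f" using sorted_nth_mono[OF sorted, of f j] j y(3) by simp
      then show ?thesis using none(2)[of y j] y j False by simp
    qed
    have exact: "exact a C f"
      using maximal_for_exact_or_linked[OF sorted R(1) max f] unlinked[OF order_refl f refl] by blast
    \<comment> \<open>A second remaining index would be orthogonal to \<open>f\<close> with the same
      value, against maximality.\<close>
    have last: "a ! f < a ! j" if j: "f < j" "j < length a" for j
    proof (rule ccontr)
      assume "\<not> a ! f < a ! j"
      then have eq: "a ! j = a ! f" using sorted_nth_mono[OF sorted, of f j] j by simp
      show False
      proof (rule maximal_for_orthogonal_parity[OF two sorted R(1) max f j(2)])
        show "f \<noteq> j" "a ! f \<le> a ! j" "even (a ! f + a ! j)" using j eq by simp_all
        show "exact a C f" by (rule exact)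
        show "\<not> linked a C f k" if "k < length a" "k \<noteq> f" "a ! k \<le> a ! j" for k
          using unlinked[OF order_refl f refl that(1,2)] that(3) eq by simp
        show "\<not> linked a C j k" if "k < length a" "k \<noteq> j" "a ! k \<le> a ! j" for k
          by (rule unlinked[OF less_imp_le[OF j(1)] j(2) eq that])
      qed
    qed
    \<comment> \<open>A waiting fixed point of the same parity could be merged with \<open>f\<close>
      in the same way: it too is exact and has no link up to the value \<open>a ! f\<close>.\<close>
    have unique: "odd (a ! z + a ! f)" if z: "z < f" "\<sigma> z = z" for z
    proof
      assume even: "even (a ! z + a ! f)"
      have zn: "z < length a" using z(1) f by simp
      show False
      proof (rule maximal_for_orthogonal_parity[OF two sorted R(1) max zn f])
        show "z \<noteq> f" using z(1) by simp
        show "a ! z \<le> a ! f" using sorted_nth_mono[OF sorted, of z f] z(1) f by simp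
        show "even (a ! z + a ! f)" by (rule even)
        show "exact a C z" using R(4)[OF z(1)] z(2) by (simp add: opener_def)
        show "\<not> linked a C z k" if k: "k < length a" "k \<noteq> z" "a ! k \<le> a ! f" for k
        proof
          assume l: "linked a C z k"
          have "f \<le> k" using R(5)[OF z(1) k(1,2) _ l] k(2) z(2) by simp
          moreover from this have "a ! k = a ! f"
            using sorted_nth_mono[OF sorted, of f k] k by simp
          ultimately show False using none(1)[OF z _ k(1)] l by blast
        qed
        show "\<not> linked a C f k" if "k < length a" "k \<noteq> f" "a ! k \<le> a ! f" for k
          by (rule unlinked[OF order_refl f refl that])
      qed
    qed
    have std: "standard_upto a \<sigma> (Suc f)"
      by (rule standard_upto_fixed[OF sorted R(2) f last unique])
    have ff: "\<sigma> f = f" using fixed_new by simp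
    have "linked a C i (\<sigma> i)" if "i < Suc f" "\<sigma> i \<noteq> i" for i
      using R(3)[of i] that ff by (cases "i = f") auto
    moreover have "exact a C i" if "i < Suc f" "opener a \<sigma> i" for i
      using R(4)[of i] exact that by (cases "i = f") auto
    moreover have "\<sigma> i = i \<and> Suc f \<le> j"
      if i: "i < Suc f" and j: "j < length a" "j \<noteq> i" "j \<noteq> \<sigma> i" and l: "linked a C i j" for i j
    proof (cases "i = f")
      case True
      have "\<not> a ! j \<le> a ! f" using unlinked[OF order_refl f refl j(1)] j(2) l True by blast
      then have "\<not> j \<le> f" using sorted_nth_mono[OF sorted, of j f] f by auto
      then show ?thesis using True ff by simp
    next
      case False
      then have "i < f" using i by simp
      then have i_fixed: "\<sigma> i = i" "f \<le> j" using R(5)[OF _ j l] by blast+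
      then have "j \<noteq> f" using none(1)[OF \<open>i < f\<close> i_fixed j(1)] l by blast
      then show ?thesis using i_fixed by simp
    qed
    moreover have "\<not> linked a C i j"
      if "i < Suc f" "\<sigma> i = i" "Suc f \<le> j" "j < length a" "a ! j = a ! (Suc f - 1)" for i j
      using last[of j] that by simp
    ultimately have "reduced_upto a C \<sigma> (Suc f)"
      by (rule reduced_uptoI[OF R(1) std])
    then show thesis
      using that[of "Suc f" C \<sigma>] tri_equiv_refl[OF M_set_carrier[OF R(1)]] by blast
  qed
qed

text \<open>A step consumes one or two indices, so the induction runs over the number of unprocessed
  ones.\<close>

lemma reduced_upto_extend:
  fixes C :: "'a::nonarch_local_field mat"
  assumes two: "hord_ge 1 (2::'a)" and sorted: "sorted a"
  shows "reduced_upto a C \<sigma> f \<Longrightarrow> maximal_for a C \<Longrightarrow>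
    \<exists>D \<tau>. tri_equiv a C D \<and> reduced_upto a D \<tau> (length a)"
proof (induction "length a - f" arbitrary: C \<sigma> f rule: less_induct)
  case less
  have car: "C \<in> carrier_mat (length a) (length a)"
    using less.prems(1) by (intro M_set_carrier reduced_uptoD(1))
  have fn: "f \<le> length a" using standard_uptoD(1) reduced_uptoD(2) less.prems(1) by blast
  show ?case
  proof (cases "f = length a")
    case True
    then show ?thesis using less.prems(1) tri_equiv_refl[OF car] by blast
  next
    case False
    then have f: "f < length a" using fn by simp
    obtain D \<tau> f' where D: "f < f'" "tri_equiv a C D" "reduced_upto a D \<tau> f'"
      by (rule reduced_upto_step[OF two sorted less.prems f])
    have "length a - f' < length a - f" using D(1) f by simp
    from less.hyps[OF this D(3) maximal_for_tri_equiv[OF car less.prems(2) D(2)]]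
    show ?thesis using tri_equiv_trans[OF car D(2)] by blast
  qed
qed

lemma reduced_upto_zero: "C \<in> M_set a \<Longrightarrow> reduced_upto a C id 0"
  by (simp add: reduced_upto_def standard_upto_def permutes_id)

section \<open>Determinants and the existence of the Gross-Keating invariant\<close>

text \<open>In each Leibniz term the row and the column indices both run once through all indices,
  so every \<open>g i\<close> is counted twice.\<close>

lemma hord_ge_det:
  assumes A: "A \<in> carrier_mat n n"
    and ge: "\<And>i j. i < n \<Longrightarrow> j < n \<Longrightarrow> hord_ge (g i + g j) (A $$ (i, j))"
  shows "hord_ge (2 * (\<Sum>i<n. g i)) (det A)"
  unfolding det_def'[OF A]
proof (intro hord_ge_sum)
  fix p assume "p \<in> {p. p permutes {0..<n}}"
  then have p: "p permutes {..<n}" by (simp add: atLeast0LessThan)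
  have "hord_ge (\<Sum>i\<in>{0..<n}. g i + g (p i)) (\<Prod>i = 0..<n. A $$ (i, p i))"
    using permutes_in_image[OF p] by (intro hord_ge_prod ge) auto
  moreover have "(\<Sum>i\<in>{0..<n}. g i + g (p i)) = 2 * (\<Sum>i<n. g i)"
    using sum.permute[OF p, of g] by (simp add: sum.distrib atLeast0LessThan)
  moreover have "hord_ge 0 (signof p)" by (simp add: sign_def)
  ultimately show "hord_ge (2 * (\<Sum>i<n. g i)) (signof p * (\<Prod>i = 0..<n. A $$ (i, p i)))"
    using hord_ge_mult by fastforce
qed

text \<open>The doubled matrix is used because \<open>M_set\<close> bounds the doubled off-diagonal
  entries; the diagonal entries only gain.\<close>

lemma M_set_hord_ge_det:
  assumes C: "C \<in> M_set b"
  shows "hord_ge (2 * (\<Sum>i<length b. int (b ! i))) (det (2 \<cdot>\<^sub>m C))"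
proof (rule hord_ge_det)
  have car: "C \<in> carrier_mat (length b) (length b)" using C by (rule M_set_carrier)
  then show "2 \<cdot>\<^sub>m C \<in> carrier_mat (length b) (length b)" by simp
  fix i j assume ij: "i < length b" "j < length b"
  have "hord_ge (0 + 2 * int (b ! i)) (2 * C $$ (i, i))"
    by (intro hord_ge_mult hord_ge_two M_setD(2)[OF C ij(1) ij(1)])
  then show "hord_ge (int (b ! i) + int (b ! j)) ((2 \<cdot>\<^sub>m C) $$ (i, j))"
    using car ij M_setD(3)[OF C ij] by (cases "i = j") simp_all
qed

lemma GL_integral_mat_act_inverse:
  assumes B: "B \<in> carrier_mat n n" and U: "U \<in> GL_integral n"
  obtains V where "V \<in> GL_integral n" "mat_act (mat_act B U) V = B"
proof -
  obtain V where V: "V \<in> integral_mat n" "U * V = 1\<^sub>m n" "V * U = 1\<^sub>m n"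
    using U by (auto simp: GL_integral_iff)
  moreover have "U \<in> integral_mat n" using U by (simp add: GL_integral_iff)
  ultimately have "V \<in> GL_integral n" unfolding GL_integral_iff by blast
  moreover have "mat_act (mat_act B U) V = B"
    using mat_act_mult[OF B GL_integral_carrier[OF U]] V mat_act_one[OF B]
    by (simp add: integral_mat_iff)
  ultimately show thesis using that by blast
qed

lemma det_mat_act:
  assumes B: "B \<in> carrier_mat n n" and U: "U \<in> carrier_mat n n"
  shows "det (mat_act B U) = det U * det U * det B"
proof -
  have "det (mat_act B U) = det (transpose_mat U) * det B * det U"
    unfolding mat_act_def using B U by (simp add: det_mult[of _ n])
  then show ?thesis using det_transpose[OF U] by (simp add: mult_ac)
qed

lemma hord_ge_det_integral: "V \<in> integral_mat n \<Longrightarrow> hord_ge 0 (det V)"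
  using hord_ge_det[of V n "\<lambda>_. 0"] by (simp add: integral_mat_iff)

lemma S_set_mat_act_length:
  assumes "B \<in> carrier_mat n n" "U \<in> GL_integral n" "b \<in> S_set (mat_act B U)"
  shows "length b = n"
proof -
  have "mat_act B U \<in> carrier_mat n n"
    by (rule mat_act_carrier[OF assms(1) GL_integral_carrier[OF assms(2)]])
  moreover have "mat_act B U \<in> carrier_mat (length b) (length b)"
    using assms(3) by (intro M_set_carrier) (simp add: S_set_def)
  ultimately show ?thesis by auto
qed

text \<open>Transforming back to \<open>B\<close> multiplies the determinant by the square of an
  integral element, so the bound for the transformed matrix also holds for \<open>B\<close>. For
  nondegenerate \<open>B\<close> this bounds the sum of the entries of every candidate.\<close>

lemma S_set_mat_act_sum_bound:
  assumes B: "B \<in> carrier_mat n n" and U: "U \<in> GL_integral n" and b: "b \<in> S_set (mat_act B U)"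
  shows "hord_ge (2 * (\<Sum>i<n. int (b ! i))) (det (2 \<cdot>\<^sub>m B))"
proof -
  define C where "C = mat_act B U"
  have C: "C \<in> carrier_mat n n" unfolding C_def by (intro mat_act_carrier B GL_integral_carrier U)
  obtain V where V: "V \<in> GL_integral n" "mat_act C V = B"
    using GL_integral_mat_act_inverse[OF B U] unfolding C_def by blast
  have "det B = det V * det V * det C"
    using det_mat_act[OF C GL_integral_carrier[OF V(1)]] V(2) by simp
  then have "det (2 \<cdot>\<^sub>m B) = det V * det V * det (2 \<cdot>\<^sub>m C)"
    using B C by simp
  moreover have "hord_ge 0 (det V)" using V(1) hord_ge_det_integral by (auto simp: GL_integral_iff)
  moreover have "hord_ge (2 * (\<Sum>i<n. int (b ! i))) (det (2 \<cdot>\<^sub>m C))"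
    using M_set_hord_ge_det[of C b] b S_set_mat_act_length[OF B U b] by (simp add: S_set_def C_def)
  ultimately show ?thesis
    using hord_ge_mult[OF hord_ge_mult] by fastforce
qed

text \<open>The determinant bound leaves finitely many candidates, and the zero tuple is one of them
  because half-integrality is membership in \<open>M_set\<close> of the zero tuple.\<close>

lemma is_GK_exists:
  fixes B :: "'a::discretely_valued_field mat"
  assumes B: "B \<in> half_integral_nd n"
  obtains a where "is_GK B a"
proof -
  have hB: "B \<in> half_integral n" and nd: "det B \<noteq> 0" using B by (auto simp: half_integral_nd_def)
  then have car: "B \<in> carrier_mat n n" by (simp add: half_integral_def)
  define T where "T = (\<Union>U \<in> GL_integral (dim_row B). S_set (mat_act B U))"
  have T: "b \<in> T \<longleftrightarrow> (\<exists>U \<in> GL_integral n. b \<in> S_set (mat_act B U))" for b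
    using car by (simp add: T_def)
  have "det (2 \<cdot>\<^sub>m B) \<noteq> 0" using nd by simp
  then obtain k :: int where k: "\<And>m. hord_ge m (det (2 \<cdot>\<^sub>m B)) \<longleftrightarrow> m \<le> 2 * k"
    using hord_ge_cases by blast
  have "T \<subseteq> {b. set b \<subseteq> {..nat k} \<and> length b = n}"
  proof
    fix b assume "b \<in> T"
    then obtain U where U: "U \<in> GL_integral n" "b \<in> S_set (mat_act B U)" using T by blast
    have len: "length b = n" by (rule S_set_mat_act_length[OF car U])
    have "(\<Sum>i<n. int (b ! i)) \<le> k" using S_set_mat_act_sum_bound[OF car U] k by simp
    then have "b ! i \<le> nat k" if "i < n" for i
      using member_le_sum[of i "{..<n}" "\<lambda>i. int (b ! i)"] that by simp
    then have "set b \<subseteq> {..nat k}" using len by (auto simp: in_set_conv_nth)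
    then show "b \<in> {b. set b \<subseteq> {..nat k} \<and> length b = n}" using len by simp
  qed
  then have fin: "finite T" by (rule finite_subset) (simp add: finite_lists_length_eq)
  define b0 where "b0 = replicate n (0::nat)"
  have "B \<in> M_set b0"
    using hB unfolding M_set_def half_integral_def valuation_ring_iff vord_ge_iff vord_ge_half_iff
    by (simp add: b0_def)
  then have "b0 \<in> S_set (mat_act B (1\<^sub>m n))"
    by (simp add: S_set_def mat_act_one[OF car]) (simp add: b0_def sorted_replicate)
  then have "b0 \<in> T" using T one_GL_integral by blast
  define r where "r = lex (less_than) \<inter> T \<times> T"
  \<comment> \<open>A minimal element of the converse order is a lexicographically maximal
    candidate; totality then makes it the greatest.\<close>
  have "wf (r\<inverse>)"
  proof (rule finite_acyclic_wf_converse)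
    show "finite r" using fin by (simp add: r_def)
    have "acyclic (lex less_than)" by (intro wf_acyclic wf_lex wf_less_than)
    then show "acyclic r" by (rule acyclic_subset) (simp add: r_def)
  qed
  then obtain a where a: "a \<in> T" "\<And>b. (b, a) \<in> r\<inverse> \<Longrightarrow> b \<notin> T"
    using wfE_min[OF _ \<open>b0 \<in> T\<close>] by metis
  have "b = a \<or> (b, a) \<in> lex less_than" if b: "b \<in> T" for b
  proof -
    have "length b = length a" using S_set_mat_act_length[OF car] T a(1) b by metis
    moreover have "(a, b) \<notin> r" using a(2)[of b] b by blast
    then have "(a, b) \<notin> lex less_than" using a(1) b unfolding r_def by blast
    moreover have "(b, a) \<in> lexord less_than \<or> b = a \<or> (a, b) \<in> lexord less_than"
      by (intro lexord_linear allI) (simp only: less_than_iff, linarith)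
    ultimately show ?thesis unfolding lexord_lex by (simp, elim disjE, simp_all)
  qed
  then have "is_GK B a" unfolding is_GK_def Let_def T_def[symmetric] using a(1) by blast
  then show thesis by (rule that)
qed

text \<open>Equivalent forms have the same orbit, so the same set of candidates is
  maximized.\<close>

lemma is_GK_mat_act:
  fixes B :: "'a::discretely_valued_field mat"
  assumes B: "B \<in> carrier_mat n n" and U: "U \<in> GL_integral n" and GK: "is_GK B a"
  shows "is_GK (mat_act B U) a"
proof -
  let ?T = "\<lambda>B :: 'a mat. \<Union>U \<in> GL_integral n. S_set (mat_act B U)"
  have sub: "?T (mat_act B U) \<subseteq> ?T B" if "B \<in> carrier_mat n n" "U \<in> GL_integral n" for B U :: "'a mat"
  proof
    fix b assume "b \<in> ?T (mat_act B U)"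
    then obtain W where W: "W \<in> GL_integral n" "b \<in> S_set (mat_act (mat_act B U) W)" by blast
    then have "b \<in> S_set (mat_act B (U * W))"
      using mat_act_mult[OF that(1)] GL_integral_carrier that(2) by metis
    then show "b \<in> ?T B" using GL_integral_mult[OF that(2) W(1)] by blast
  qed
  have C: "mat_act B U \<in> carrier_mat n n" by (intro mat_act_carrier B GL_integral_carrier U)
  obtain V where V: "V \<in> GL_integral n" "mat_act (mat_act B U) V = B"
    using GL_integral_mat_act_inverse[OF B U] by blast
  have "?T (mat_act B U) = ?T B" using sub[OF B U] sub[OF C V(1)] V(2) by auto
  then show ?thesis using GK B C by (simp add: is_GK_def Let_def)
qed

lemma is_GK_unique:
  assumes "is_GK B a" "is_GK B b"
  shows "a = b"
proof (rule ccontr)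
  assume "a \<noteq> b"
  then have "(a, b) \<in> lex less_than" "(b, a) \<in> lex less_than"
    using assms unfolding is_GK_def Let_def by metis+
  then show False using wf_not_sym[OF wf_lex[OF wf_less_than]] by blast
qed

lemma is_GK_maximal_for:
  assumes "is_GK B a" "B \<in> carrier_mat (length a) (length a)"
  shows "maximal_for a B"
proof -
  have "dim_row B = length a" using assms(2) by simp
  then show ?thesis using assms(1) unfolding is_GK_def Let_def maximal_for_def by simp
qed

section \<open>Reduced forms\<close>

lemma det_two_by_two:
  assumes A: "A \<in> carrier_mat 2 2"
  shows "det A = A $$ (0, 0) * A $$ (1, 1) - A $$ (0, 1) * A $$ (1, 0)"
proof -
  have S: "{0..<2::nat} = {0, 1}" by auto
  have "id \<noteq> transpose 0 (1::nat)" by (metis id_apply transpose_apply_first zero_neq_one)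
  moreover have "{p. p permutes {0..<2::nat}} = {id, transpose 0 1}"
    unfolding S permutes_doubleton_iff by auto
  ultimately show ?thesis
    unfolding det_def'[OF A] by (simp add: S sign_swap_id)
qed

text \<open>In the determinant of the doubled matrix, \<open>2 * x * (2 * z)\<close> gains order
  from both factors 2, so the order is that of \<open>(2 * y) ^ 2\<close>, namely
  \<open>p + q\<close>. This bounds the sum of any candidate; it remains to bound its first entry by
  \<open>p\<close>.\<close>

lemma is_GK_two_by_two:
  fixes x y z :: "'a::discretely_valued_field"
  assumes two: "hord_ge 1 (2::'a)" and le: "p \<le> q"
    and x: "hord_ge (2 * int p) x" and z: "hord_ge (2 * int q) z"
    and y: "hord_ge (int p + int q) (2 * y)" "\<not> hord_ge (int p + int q + 1) (2 * y)"
    and exact: "p < q \<Longrightarrow> \<not> hord_ge (2 * int p + 1) x"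
  shows "is_GK (mat_of_rows_list 2 [[x, y], [y, z]]) [p, q]"
proof -
  define B where "B = mat_of_rows_list 2 [[x, y], [y, z]]"
  have car: "B \<in> carrier_mat 2 2" by (rule carrier_matI) (simp_all add: B_def mat_of_rows_list_def)
  have entries: "B $$ (0, 0) = x" "B $$ (0, 1) = y" "B $$ (1, 0) = y" "B $$ (1, 1) = z"
    by (simp_all add: B_def mat_of_rows_list_def)
  have "B \<in> M_set [p, q]"
    unfolding M_set_iff
  proof (intro conjI allI impI)
    show "B \<in> carrier_mat (length [p, q]) (length [p, q])" using car by (simp add: numeral_2_eq_2)
    fix i j assume "i < length [p, q]" "j < length [p, q]"
    then have "(i = 0 \<or> i = 1) \<and> (j = 0 \<or> j = 1)" by auto
    then show "B $$ (i, j) = B $$ (j, i)" using entries by auto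
    from \<open>_ \<and> _\<close> show "hord_ge (int ([p, q] ! i) + int ([p, q] ! j)) (2 * B $$ (i, j))" if "i \<noteq> j"
      using that y(1) by (elim conjE disjE) (simp_all add: entries[unfolded One_nat_def] add.commute)
  next
    fix i assume "i < length [p, q]"
    then have "i = 0 \<or> i = 1" by auto
    then show "hord_ge (2 * int ([p, q] ! i)) (B $$ (i, i))"
      using x z by (elim disjE) (simp_all add: entries[unfolded One_nat_def])
  qed
  then have mem: "[p, q] \<in> S_set (mat_act B (1\<^sub>m 2))"
    using le by (simp add: S_set_def mat_act_one[OF car])
  have det: "\<not> hord_ge (2 * (int p + int q) + 1) (det (2 \<cdot>\<^sub>m B))"
  proof
    assume "hord_ge (2 * (int p + int q) + 1) (det (2 \<cdot>\<^sub>m B))"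
    moreover have "det (2 \<cdot>\<^sub>m B) = 2 * x * (2 * z) - 2 * y * (2 * y)"
      using det_two_by_two[of "2 \<cdot>\<^sub>m B"] car entries by simp
    moreover have "hord_ge ((1 + 2 * int p) + (1 + 2 * int q)) (2 * x * (2 * z))"
      by (intro hord_ge_mult two x z)
    then have "hord_ge (2 * (int p + int q) + 1) (2 * x * (2 * z))"
      by (rule hord_ge_mono) simp
    ultimately have "hord_ge (2 * (int p + int q) + 1) (2 * x * (2 * z) - (2 * x * (2 * z) - 2 * y * (2 * y)))"
      by (metis hord_ge_diff)
    then show False
      using not_hord_ge_mult[OF y(2) y(2)] by (simp add: algebra_simps)
  qed
  have "b = [p, q] \<or> (b, [p, q]) \<in> lex less_than"
    if U: "U \<in> GL_integral 2" and b: "b \<in> S_set (mat_act B U)" for U b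
  proof -
    have "length b = 2" by (rule S_set_mat_act_length[OF car U b])
    then obtain r s where rs: "b = [r, s]" by (auto simp: numeral_2_eq_2 length_Suc_conv)
    have "(\<Sum>i<2. int (b ! i)) = int r + int s" by (simp add: rs numeral_2_eq_2)
    then have "hord_ge (2 * (int r + int s)) (det (2 \<cdot>\<^sub>m B))"
      using S_set_mat_act_sum_bound[OF car U b] by simp
    then have "\<not> 2 * (int p + int q) + 1 \<le> 2 * (int r + int s)"
      using hord_ge_mono det by blast
    then have sum: "r + s \<le> p + q" by presburger
    have "r \<le> s" using b rs by (simp add: S_set_def)
    \<comment> \<open>For \<open>p = q\<close> the sum bound and \<open>r \<le> s\<close> suffice.
      Otherwise \<open>x\<close> is a value of the form of order \<open>p\<close>, whereas
      membership in \<open>M_set [r, s]\<close> forces all values on integral vectors to have order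
      at least \<open>r\<close>.\<close>
    have "r \<le> p"
    proof (cases "p = q")
      case True
      then show ?thesis using sum \<open>r \<le> s\<close> by simp
    next
      case False
      then have xp: "\<not> hord_ge (2 * int p + 1) x" using exact le by simp
      obtain V where V: "V \<in> GL_integral 2" "mat_act (mat_act B U) V = B"
        using GL_integral_mat_act_inverse[OF car U] by blast
      define C where "C = mat_act B U"
      have C: "C \<in> carrier_mat 2 2" "C \<in> M_set [r, s]" 
        using mat_act_carrier[OF car GL_integral_carrier[OF U]] b rs by (simp_all add: C_def S_set_def)
      have Vi: "hord_ge 0 (V $$ (i, j))" if "i < 2" "j < 2" for i j
        using V(1) that by (auto simp: GL_integral_iff integral_mat_iff)
      have Vc: "V \<in> carrier_mat 2 2" using V(1) by (rule GL_integral_carrier)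
      have C01: "C $$ (1, 0) = C $$ (0, 1)" using M_setD(1)[OF C(2), of 1 0] by simp
      \<comment> \<open>\<open>x\<close> is the value of the transformed form at the first column of
        \<open>V\<close>.\<close>
      have "x = mat_act C V $$ (0, 0)" using V(2) entries(1) by (simp add: C_def)
      also have "\<dots> = V $$ (0, 0) * V $$ (0, 0) * C $$ (0, 0) + V $$ (0, 0) * V $$ (1, 0) * (2 * C $$ (0, 1)) +
          V $$ (1, 0) * V $$ (1, 0) * C $$ (1, 1)"
      proof -
        have sum2: "(\<Sum>k<2. h k) = h 0 + h 1" for h :: "nat \<Rightarrow> 'a"
          by (simp add: numeral_2_eq_2)
        have VC: "transpose_mat V * C \<in> carrier_mat 2 2" using Vc C(1) by simp
        have "(transpose_mat V * C) $$ (0, k) = V $$ (0, 0) * C $$ (0, k) + V $$ (1, 0) * C $$ (1, k)"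
          if "k < 2" for k
          using times_mat_index[of "transpose_mat V" 2 C 0 k] Vc C(1) that unfolding sum2 by simp
        from this[of 0] this[of 1] show ?thesis
          unfolding mat_act_def times_mat_index[OF VC Vc zero_less_numeral zero_less_numeral] sum2
          using C01 by (simp add: algebra_simps)
      qed
      also have "hord_ge (2 * int r) \<dots>"
      proof (intro hord_ge_add)
        have "hord_ge (0 + 0 + 2 * int r) (V $$ (0, 0) * V $$ (0, 0) * C $$ (0, 0))"
          using M_setD(2)[OF C(2), of 0 0] by (intro hord_ge_mult Vi) simp_all
        then show "hord_ge (2 * int r) (V $$ (0, 0) * V $$ (0, 0) * C $$ (0, 0))" by simp
        have "hord_ge (int r + int s) (2 * C $$ (0, 1))"
          using M_setD(3)[OF C(2), of 0 1] by simp
        with Vi have "hord_ge (0 + 0 + (int r + int s)) (V $$ (0, 0) * V $$ (1, 0) * (2 * C $$ (0, 1)))"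
          by (intro hord_ge_mult[OF hord_ge_mult]) simp_all
        then show "hord_ge (2 * int r) (V $$ (0, 0) * V $$ (1, 0) * (2 * C $$ (0, 1)))"
          by (rule hord_ge_mono) (use \<open>r \<le> s\<close> in simp)
        have "hord_ge (0 + 0 + 2 * int s) (V $$ (1, 0) * V $$ (1, 0) * C $$ (1, 1))"
          using M_setD(2)[OF C(2), of 1 1] by (intro hord_ge_mult Vi) simp_all
        then show "hord_ge (2 * int r) (V $$ (1, 0) * V $$ (1, 0) * C $$ (1, 1))"
          by (rule hord_ge_mono) (use \<open>r \<le> s\<close> in simp)
      qed
      finally have "hord_ge (2 * int r) x" .
      then show ?thesis using xp hord_ge_mono[of "2 * int r" x "2 * int p + 1"] by linarith
    qed
    then show ?thesis using sum by (auto simp: rs)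
  qed
  then show ?thesis
    unfolding B_def[symmetric] is_GK_def Let_def using mem car by auto
qed

text \<open>With \<open>f = length a\<close> no unprocessed index remains to which a fixed point
  could be linked, so every entry outside the pairs is strictly above its bound.\<close>

lemma reduced_upto_length_imp_reduced_form:
  fixes C :: "'a::discretely_valued_field mat"
  assumes two: "hord_ge 1 (2::'a)" and sorted: "sorted a" and C: "reduced_upto a C \<sigma> (length a)"
  shows "standard_admissible a \<sigma>" "reduced_form_of_type a \<sigma> C"
proof -
  note R = reduced_uptoD[OF C]
  note S = standard_uptoD[OF R(2)]
  show std: "standard_admissible a \<sigma>"
    by (rule standard_upto_length_imp_standard_admissible[OF sorted R(2)])
  have "is_GK (mat_of_rows_list 2 [[C $$ (i, i), C $$ (i, \<sigma> i)], [C $$ (i, \<sigma> i), C $$ (\<sigma> i, \<sigma> i)]])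
      [a ! i, a ! \<sigma> i]"
    if i: "i < length a" "i \<notin> P_zero a \<sigma>" "a ! i \<le> a ! \<sigma> i" for i
  proof (rule is_GK_two_by_two[OF two i(3)])
    have ne: "\<sigma> i \<noteq> i" using i by (simp add: P_zero_def)
    have si: "\<sigma> i < length a" using S(4) i(1) .
    show "hord_ge (2 * int (a ! i)) (C $$ (i, i))" "hord_ge (2 * int (a ! \<sigma> i)) (C $$ (\<sigma> i, \<sigma> i))"
      using M_setD(2)[OF R(1)] i(1) si by blast+
    show "hord_ge (int (a ! i) + int (a ! \<sigma> i)) (2 * C $$ (i, \<sigma> i))"
      using M_setD(3)[OF R(1) i(1) si] ne by simp
    show "\<not> hord_ge (int (a ! i) + int (a ! \<sigma> i) + 1) (2 * C $$ (i, \<sigma> i))"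
      using R(3)[OF i(1) ne] by (simp add: linked_def)
    show "\<not> hord_ge (2 * int (a ! i) + 1) (C $$ (i, i))" if "a ! i < a ! \<sigma> i"
      using R(4)[OF i(1)] that by (simp add: opener_def exact_def)
  qed
  moreover have "vord (C $$ (i, i)) = ereal (real (a ! i))" if "i \<in> P_zero a \<sigma>" for i
    using that R(4)[of i] M_setD(2)[OF R(1), of i i]
    by (simp add: vord_eq_iff P_zero_def opener_def exact_def)
  moreover have "vord (2 * C $$ (i, j)) > ereal ((real (a ! i) + real (a ! j)) / 2)"
    if "i < length a" "j < length a" "j \<noteq> i" "j \<noteq> \<sigma> i" for i j
  proof -
    have "\<not> linked a C i j" using R(5)[OF that] that(2) by auto
    then show ?thesis by (simp add: linked_def vord_gt_half_iff)
  qed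
  ultimately show "reduced_form_of_type a \<sigma> C"
    unfolding reduced_form_of_type_def using std R(1) by (auto simp: standard_admissible_def)
qed

lemma optimal_imp_reduced:
  fixes B :: "'a::nonarch_local_field mat"
  assumes two: "hord_ge 1 (2::'a)" and B: "B \<in> half_integral_nd (length a)"
    and opt: "optimal B" and GK: "is_GK B a"
  shows "\<exists>U \<in> G_tri a. \<exists>\<sigma>. standard_admissible a \<sigma> \<and> reduced_form_of_type a \<sigma> (mat_act B U)"
proof -
  have car: "B \<in> carrier_mat (length a) (length a)"
    using B by (simp add: half_integral_nd_def half_integral_def)
  have "a \<in> S_set B" using opt GK is_GK_unique unfolding optimal_def by blast
  then have M: "B \<in> M_set a" and sorted: "sorted a" by (simp_all add: S_set_def)
  obtain C \<sigma> where "tri_equiv a B C" "reduced_upto a C \<sigma> (length a)"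
    using reduced_upto_extend[OF two sorted reduced_upto_zero[OF M] is_GK_maximal_for[OF GK car]] by blast
  then show ?thesis
    using reduced_upto_length_imp_reduced_form[OF two sorted] unfolding tri_equiv_def by blast
qed

theorem theorem4p1:
  assumes "dyadic TYPE('a::nonarch_local_field)"
  shows "(\<forall>(n::nat) (a::nat list) (B::'a mat).
            length a = n \<and> sorted a \<and> B \<in> half_integral_nd n \<and> optimal B \<and> is_GK B a \<longrightarrow>
            (\<exists>U \<in> G_tri a. \<exists>\<sigma>. standard_admissible a \<sigma> \<and>
               reduced_form_of_type a \<sigma> (mat_act B U))) \<and>
         (\<forall>(n::nat) (B::'a mat). B \<in> half_integral_nd n \<longrightarrow>
            (\<exists>B'. mat_equivalent B B' \<and> reduced_form B'))"
proof (intro conjI allI impI)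
  have two: "hord_ge 1 (2::'a)" by (rule dyadic_hord_ge_two[OF assms])
  show "\<exists>U \<in> G_tri a. \<exists>\<sigma>. standard_admissible a \<sigma> \<and> reduced_form_of_type a \<sigma> (mat_act B U)"
    if "length a = n \<and> sorted a \<and> B \<in> half_integral_nd n \<and> optimal B \<and> is_GK B a"
    for n a and B :: "'a mat"
    using optimal_imp_reduced[OF two] that by blast
  fix n and B :: "'a mat"
  assume B: "B \<in> half_integral_nd n"
  then have car: "B \<in> carrier_mat n n" and nd: "det B \<noteq> 0"
    by (simp_all add: half_integral_nd_def half_integral_def)
  \<comment> \<open>The invariant is attained on some form in the orbit. That form is optimal and
    nondegenerate, so the first assertion applies to it.\<close>
  obtain a where GK: "is_GK B a" using is_GK_exists[OF B] by blast
  then obtain U where U: "U \<in> GL_integral n" "a \<in> S_set (mat_act B U)"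
    using car unfolding is_GK_def Let_def by auto
  have len: "length a = n" by (rule S_set_mat_act_length[OF car U])
  define C where "C = mat_act B U"
  have "det C \<noteq> 0"
  proof -
    obtain V where V: "V \<in> integral_mat n" "U * V = 1\<^sub>m n"
      using U(1) by (auto simp: GL_integral_iff)
    have "det U * det V = 1"
      using det_mult[OF GL_integral_carrier[OF U(1)], of V] V by (simp add: integral_mat_iff)
    then have "det U \<noteq> 0" by auto
    then show ?thesis using nd det_mat_act[OF car GL_integral_carrier[OF U(1)]] by (simp add: C_def)
  qed
  moreover have "C \<in> half_integral (length a)" using U(2) by (simp add: S_set_def M_set_def C_def)
  ultimately have "C \<in> half_integral_nd (length a)" by (simp add: half_integral_nd_def)
  moreover have "is_GK C a" unfolding C_def by (rule is_GK_mat_act[OF car U(1) GK])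
  moreover from this have "optimal C" using U(2) unfolding optimal_def C_def by blast
  ultimately obtain W \<sigma> where W: "W \<in> G_tri a" "reduced_form_of_type a \<sigma> (mat_act C W)"
    using optimal_imp_reduced[OF two] by blast
  have WG: "W \<in> GL_integral n" using G_tri_GL[OF W(1)] len by simp
  have "mat_act C W = mat_act B (U * W)"
    unfolding C_def by (rule mat_act_mult[OF car GL_integral_carrier[OF U(1)] GL_integral_carrier[OF WG]])
  then have "mat_equivalent B (mat_act C W)"
    unfolding mat_equivalent_def using car GL_integral_mult[OF U(1) WG] by auto
  then show "\<exists>B'. mat_equivalent B B' \<and> reduced_form B'"
    using W(2) unfolding reduced_form_def by blast
qed

end
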